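(* For any region $R\subseteq\mathbb{R}^d$, any $c>0$ and any $x\in\mathbb{R}^d$, $$|I_R(x)-\tilde I_R^c(x)|\le\min\left\{1,\;O\!\left(\left(\frac{d}{c\cdot d_2(x,\partial R)}\right)^2\right)\right\},$$ with an absolute implied constant.
   Context: $I_R$ is the indicator function of $R$. $\partial R$ is the set of points $x$ such that every ball around $x$ of positive radius meets both $R$ and $\mathbb{R}^d\setminus R$; $d_2(x,S)$ is the Euclidean distance from $x$ to $S$. Let $b(x)=\sqrt{C_d}(1-\|x\|_2^2)$ for $\|x\|_2<1$ and $0$ otherwise, with $C_d$ chosen so $\|b\|_2=1$; $\hat b(t)=(2\pi)^{-d/2}\int b(x)e^{-i\langle x,t\rangle}dx$; $B=\hat b^2$; $B_c(x)=c^dB(cx)$. For bounded $F$, $\tilde F^c=B_c*F$, i.e. $\tilde F^c(x)=\int B_c(y)F(x-y)dy$. *)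

theory Defs
  imports "HOL-Analysis.Analysis"
begin

text \<open>
  The implied constant in the theorem must not depend on the dimension, so the dimension has to be
  a bound natural number and cannot be a type. Points of \<open>\<real>\<^sup>d\<close> are therefore functions
  \<open>nat \<Rightarrow> real\<close> that are \<open>undefined\<close> outside \<open>{..<d}\<close>, as in the library's finite products of
  measures.
\<close>

type_synonym point = "nat \<Rightarrow> real"

definition Rd :: "nat \<Rightarrow> point set" where
  "Rd d = (\<Pi>\<^sub>E i\<in>{..<d}. UNIV)"

definition lebesgue_Rd :: "nat \<Rightarrow> point measure" where
  "lebesgue_Rd d = completion (\<Pi>\<^sub>M i\<in>{..<d}. lborel)"

lemma space_lebesgue_Rd: "space (lebesgue_Rd d) = Rd d"
  by (simp add: lebesgue_Rd_def Rd_def space_PiM)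

definition norm2 :: "nat \<Rightarrow> point \<Rightarrow> real" where
  "norm2 d x = L2_set x {..<d}"

definition inner_Rd :: "nat \<Rightarrow> point \<Rightarrow> point \<Rightarrow> real" where
  "inner_Rd d x y = (\<Sum>i<d. x i * y i)"

definition diff_Rd :: "nat \<Rightarrow> point \<Rightarrow> point \<Rightarrow> point" where
  "diff_Rd d x y = (\<lambda>i\<in>{..<d}. x i - y i)"

definition scale_Rd :: "nat \<Rightarrow> real \<Rightarrow> point \<Rightarrow> point" where
  "scale_Rd d c x = (\<lambda>i\<in>{..<d}. c * x i)"

definition ball_Rd :: "nat \<Rightarrow> point \<Rightarrow> real \<Rightarrow> point set" where
  "ball_Rd d x r = {y \<in> Rd d. norm2 d (diff_Rd d x y) < r}"

definition boundary_Rd :: "nat \<Rightarrow> point set \<Rightarrow> point set" where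
  "boundary_Rd d R =
    {x \<in> Rd d. \<forall>r>0. ball_Rd d x r \<inter> R \<noteq> {} \<and> ball_Rd d x r \<inter> (Rd d - R) \<noteq> {}}"

text \<open>
  The distance is extended-valued: the distance to the empty set (which is the boundary of the
  empty set and of the whole space) is \<open>\<infinity>\<close>.
\<close>

definition d2 :: "nat \<Rightarrow> point \<Rightarrow> point set \<Rightarrow> ennreal" where
  "d2 d x S = (INF y\<in>S. ennreal (norm2 d (diff_Rd d x y)))"

definition bump :: "nat \<Rightarrow> real \<Rightarrow> point \<Rightarrow> real" where
  "bump d C x = (if norm2 d x < 1 then sqrt C * (1 - (norm2 d x)\<^sup>2) else 0)"

definition C_const :: "nat \<Rightarrow> real" where
  "C_const d = (THE C. C > 0 \<and> sqrt (\<integral>x. \<bar>bump d C x\<bar>\<^sup>2 \<partial>lebesgue_Rd d) = 1)"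

definition b :: "nat \<Rightarrow> point \<Rightarrow> real" where
  "b d x = bump d (C_const d) x"

definition b_hat :: "nat \<Rightarrow> point \<Rightarrow> complex" where
  "b_hat d t = complex_of_real ((2 * pi) powr (- real d / 2)) *
     (\<integral>x. complex_of_real (b d x) * exp (- \<i> * complex_of_real (inner_Rd d x t)) \<partial>lebesgue_Rd d)"

text \<open>
  \<open>B\<close> is the plain square of the Fourier transform (no modulus), hence formally complex-valued; it
  takes real values because \<open>b\<close> is real and even.
\<close>

definition B :: "nat \<Rightarrow> point \<Rightarrow> complex" where
  "B d t = (b_hat d t)\<^sup>2"

definition B_scaled :: "nat \<Rightarrow> real \<Rightarrow> point \<Rightarrow> complex" where
  "B_scaled d c x = complex_of_real (c ^ d) * B d (scale_Rd d c x)"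

definition mollify :: "nat \<Rightarrow> real \<Rightarrow> (point \<Rightarrow> real) \<Rightarrow> point \<Rightarrow> complex" where
  "mollify d c F x =
     (\<integral>y. B_scaled d c y * complex_of_real (F (diff_Rd d x y)) \<partial>lebesgue_Rd d)"

end

theory Submission
  imports Defs "HOL-Probability.Characteristic_Functions"
begin

text \<open>The only dependence on the dimension that may survive is d^2, while the volume of the
  unit ball and the powers of 2 pi vary wildly with d. Hence nothing is evaluated absolutely. Both
  the energy and the L2 mass of the unnormalised bump are compared with the same number
  \<open>ball_volume d\<close>, which cancels in the quotient, and the powers of 2 pi cancel between
  Plancherel's identity and the normalisation of \<open>B\<close>. The d^2 comes from the mass
  alone: in high dimension most of the ball lies within distance of order 1/d of the sphere, where
  the bump is of order 1/d. Finite differences of step h spread the support to radius 1 + h, so h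
  has to stay below 1/d to keep the enlarged volume comparable.

  The region is only Lebesgue measurable, but every other function involved is Borel. The analysis
  therefore runs over the uncompleted product measure, and the completion matters only where the
  indicator of the region is integrated.\<close>

text \<open>
  By Plancherel, \<open>B\<close> is a probability density, which gives the bound 1. If \<open>x\<close> and \<open>x - y\<close> lie on
  different sides of the boundary of \<open>R\<close>, the segment between them meets the boundary, so
  \<open>\<parallel>y\<parallel> \<ge> r := d2 d x (boundary_Rd d R)\<close>. Chebyshev's inequality then bounds the error by the second
  moment of \<open>B\<close> divided by \<open>(c * r)\<^sup>2\<close>. Again by Plancherel, that second moment is the
  Dirichlet energy of \<open>b\<close>, which is at most of order \<open>d\<^sup>2\<close>: the gradient is bounded by
  \<open>2 * sqrt C\<close> on the unit ball, and \<open>C\<close> is at most \<open>8 * d\<^sup>2\<close> divided by the volume of that ball.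
\<close>

section \<open>Affine maps and ball volumes\<close>

text \<open>The Borel version of \<open>lebesgue_Rd\<close>. Fubini's theorem and product
  measurability are applied here; integrals of Borel functions do not change under
  completion.\<close>

abbreviation lborel_Rd :: "nat \<Rightarrow> point measure" where
  "lborel_Rd d \<equiv> \<Pi>\<^sub>M i\<in>{..<d}. lborel"

interpretation lborel_product: product_sigma_finite "\<lambda>_::nat. lborel :: real measure"
  by standard

lemma space_lborel_Rd: "space (lborel_Rd d) = Rd d"
  by (simp add: Rd_def space_PiM)

lemma sigma_finite_lborel_Rd: "sigma_finite_measure (lborel_Rd d)"
  by (rule lborel_product.sigma_finite) simp

lemma pair_sigma_finite_lborel_Rd: "pair_sigma_finite (lborel_Rd d) (lborel_Rd d)"
  by (simp add: pair_sigma_finite_def sigma_finite_lborel_Rd)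

text \<open>One family for all changes of variables below: the reflection y -> x - y, dilations,
  coordinate shifts and the points x - s y of a segment.\<close>

definition affine_Rd :: "nat \<Rightarrow> real \<Rightarrow> point \<Rightarrow> point \<Rightarrow> point" where
  "affine_Rd d c a x = (\<lambda>i\<in>{..<d}. a i + c * x i)"

lemma diff_Rd_eq_affine: "diff_Rd d x = affine_Rd d (-1) x"
  by (auto simp: diff_Rd_def affine_Rd_def fun_eq_iff)

lemma scale_Rd_eq_affine: "scale_Rd d c = affine_Rd d c (\<lambda>_. 0)"
  by (auto simp: scale_Rd_def affine_Rd_def fun_eq_iff)

lemma measurable_component_Rd [measurable]: "i < d \<Longrightarrow> (\<lambda>x. x i) \<in> borel_measurable (lborel_Rd d)"
  using measurable_component_singleton[of i "{..<d}" "\<lambda>_. lborel"] by simp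

lemma measurable_affine_Rd [measurable]: "affine_Rd d c a \<in> lborel_Rd d \<rightarrow>\<^sub>M lborel_Rd d"
  unfolding affine_Rd_def by (rule measurable_restrict) simp

lemma measurable_norm2 [measurable]: "norm2 d \<in> borel_measurable (lborel_Rd d)"
  unfolding norm2_def L2_set_def by measurable

lemma measurable_inner_Rd_pair [measurable]:
  "(\<lambda>(x, y). inner_Rd d x y) \<in> borel_measurable (lborel_Rd d \<Otimes>\<^sub>M lborel_Rd d)"
  unfolding inner_Rd_def by (auto simp: case_prod_beta intro!: borel_measurable_sum borel_measurable_times
     measurable_compose[OF measurable_fst] measurable_compose[OF measurable_snd])

lemma measurable_inner_Rd [measurable]:
  "inner_Rd d x \<in> borel_measurable (lborel_Rd d)" "(\<lambda>x. inner_Rd d x y) \<in> borel_measurable (lborel_Rd d)"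
  unfolding inner_Rd_def by measurable

lemma measurable_affine_Rd_pair:
  "(\<lambda>(x, y). affine_Rd d c x y) \<in> lborel_Rd d \<Otimes>\<^sub>M lborel_Rd d \<rightarrow>\<^sub>M lborel_Rd d"
  unfolding affine_Rd_def case_prod_beta
  by (auto intro!: measurable_restrict borel_measurable_add borel_measurable_times
     measurable_compose[OF measurable_fst] measurable_compose[OF measurable_snd])

text \<open>A product measure is determined by its values on boxes. The map acts on each coordinate
  separately, and each of the d coordinates contributes one factor \<bar>c\<bar>.\<close>

lemma lborel_Rd_affine:
  assumes "c \<noteq> 0"
  shows "lborel_Rd d = density (distr (lborel_Rd d) (lborel_Rd d) (affine_Rd d c a)) (\<lambda>_. ennreal (\<bar>c\<bar> ^ d))"
proof (rule lborel_product.PiM_eqI[symmetric])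
  fix A :: "nat \<Rightarrow> real set" assume A: "\<And>i. i \<in> {..<d} \<Longrightarrow> A i \<in> sets lborel"
  have A': "i < d \<Longrightarrow> A i \<in> sets borel" for i using A by simp
  have pre: "affine_Rd d c a -` Pi\<^sub>E {..<d} A \<inter> space (lborel_Rd d) = (\<Pi>\<^sub>E i\<in>{..<d}. (\<lambda>x. a i + c * x) -` A i)"
    by (auto simp: affine_Rd_def space_PiM PiE_iff)
  have m: "(\<lambda>x. a i + c * x) -` A i \<in> sets borel" if "i < d" for i
    using measurable_sets[of "\<lambda>x. a i + c * x" borel borel "A i"] A'[OF that] by simp
  have one: "emeasure lborel (A i) = ennreal \<bar>c\<bar> * emeasure lborel ((\<lambda>x. a i + c * x) -` A i)" if "i < d" for i
    by (subst lborel_real_affine[OF assms, of "a i"])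
      (simp add: emeasure_density_const emeasure_distr A'[OF that])
  have meas: "Pi\<^sub>E {..<d} A \<in> sets (lborel_Rd d)"
    using A by (intro sets_PiM_I_finite) auto
  have "emeasure (density (distr (lborel_Rd d) (lborel_Rd d) (affine_Rd d c a)) (\<lambda>_. ennreal (\<bar>c\<bar> ^ d))) (Pi\<^sub>E {..<d} A)
      = ennreal (\<bar>c\<bar> ^ d) * emeasure (lborel_Rd d) (\<Pi>\<^sub>E i\<in>{..<d}. (\<lambda>x. a i + c * x) -` A i)"
    by (subst emeasure_density_const) (simp_all add: meas emeasure_distr pre)
  also have "\<dots> = (\<Prod>i\<in>{..<d}. ennreal \<bar>c\<bar>) * (\<Prod>i\<in>{..<d}. emeasure lborel ((\<lambda>x. a i + c * x) -` A i))"
    by (subst lborel_product.emeasure_PiM) (auto simp: m ennreal_power)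
  also have "\<dots> = (\<Prod>i\<in>{..<d}. emeasure lborel (A i))"
    by (subst prod.distrib[symmetric]) (auto intro!: prod.cong simp: one)
  finally show "emeasure (density (distr (lborel_Rd d) (lborel_Rd d) (affine_Rd d c a)) (\<lambda>_. ennreal (\<bar>c\<bar> ^ d))) (Pi\<^sub>E {..<d} A)
      = (\<Prod>i\<in>{..<d}. emeasure lborel (A i))" .
qed auto

lemma nn_integral_affine_Rd:
  assumes "c \<noteq> 0" and [measurable]: "f \<in> borel_measurable (lborel_Rd d)"
  shows "(\<integral>\<^sup>+x. f x \<partial>lborel_Rd d) = ennreal (\<bar>c\<bar> ^ d) * (\<integral>\<^sup>+x. f (affine_Rd d c a x) \<partial>lborel_Rd d)"
  by (subst lborel_Rd_affine[OF assms(1), of d a])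
    (simp add: nn_integral_density nn_integral_distr nn_integral_cmult)

lemma integral_affine_Rd:
  fixes f :: "point \<Rightarrow> 'b::{banach, second_countable_topology}"
  assumes "c \<noteq> 0" and [measurable]: "f \<in> borel_measurable (lborel_Rd d)"
  shows "(\<integral>x. f x \<partial>lborel_Rd d) = (\<bar>c\<bar> ^ d) *\<^sub>R (\<integral>x. f (affine_Rd d c a x) \<partial>lborel_Rd d)"
  by (subst lborel_Rd_affine[OF assms(1), of d a])
    (simp add: integral_density integral_distr)

lemma integrable_affine_Rd:
  fixes f :: "point \<Rightarrow> 'b::{banach, second_countable_topology}"
  assumes "c \<noteq> 0" and f: "integrable (lborel_Rd d) f"
  shows "integrable (lborel_Rd d) (\<lambda>x. f (affine_Rd d c a x))"
proof -
  have [measurable]: "f \<in> borel_measurable (lborel_Rd d)" using f by auto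
  from f have "integrable (density (distr (lborel_Rd d) (lborel_Rd d) (affine_Rd d c a)) (\<lambda>_. ennreal (\<bar>c\<bar> ^ d))) f"
    by (subst (asm) lborel_Rd_affine[OF assms(1), of d a])
  then have "integrable (lborel_Rd d) (\<lambda>x. \<bar>c\<bar> ^ d *\<^sub>R f (affine_Rd d c a x))"
    by (simp add: integrable_density integrable_distr_eq)
  from integrable_scaleR_right[OF this, of "1 / \<bar>c\<bar> ^ d"]
  show ?thesis using assms(1) by simp
qed

text \<open>By the change of variables the preimage of \<open>N\<close> has measure 0. This is what
  lets reflections act on Lebesgue sets and not merely on Borel sets.\<close>

lemma AE_affine_Rd:
  assumes "c \<noteq> 0" and N: "N \<in> null_sets (lborel_Rd d)"
  shows "AE x in lborel_Rd d. affine_Rd d c a x \<notin> N"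
proof -
  have [measurable]: "N \<in> sets (lborel_Rd d)" using N by auto
  have "(\<integral>\<^sup>+x. indicator N (affine_Rd d c a x) \<partial>lborel_Rd d) = 0"
    using nn_integral_affine_Rd[OF assms(1), of "indicator N" d a] N assms(1)
    by (auto simp: null_sets_def)
  then have "AE x in lborel_Rd d. indicator N (affine_Rd d c a x) = (0::ennreal)"
    by (subst (asm) nn_integral_0_iff_AE) auto
  then show ?thesis by eventually_elim (auto simp: indicator_def split: if_splits)
qed

section \<open>Norms under affine maps and volumes of balls\<close>

lemma affine_Rd_in_Rd [simp]: "affine_Rd d c a x \<in> Rd d"
  by (auto simp: affine_Rd_def Rd_def)

lemma scale_Rd_in_Rd [simp]: "scale_Rd d c x \<in> Rd d"
  by (auto simp: scale_Rd_def Rd_def)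

lemma norm2_nonneg [simp]: "0 \<le> norm2 d x"
  by (simp add: norm2_def)

lemma norm2_sq: "(norm2 d x)\<^sup>2 = (\<Sum>i<d. (x i)\<^sup>2)"
  by (simp add: norm2_def L2_set_def sum_nonneg)

lemma norm2_scale_Rd: "norm2 d (scale_Rd d c x) = \<bar>c\<bar> * norm2 d x"
proof -
  have "norm2 d (scale_Rd d c x) = L2_set (\<lambda>i. \<bar>c\<bar> * x i) {..<d}"
    by (auto simp: norm2_def scale_Rd_def L2_set_def power_mult_distrib)
  then show ?thesis by (simp add: L2_set_right_distrib norm2_def)
qed

lemma abs_component_le_norm2: "j < d \<Longrightarrow> \<bar>x j\<bar> \<le> norm2 d x"
  using member_le_L2_set[of "{..<d}" j "\<lambda>i. \<bar>x i\<bar>"] by (simp add: norm2_def L2_set_def)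

text \<open>Kept as an unevaluated number; only its finiteness, positivity and scaling
  enter.\<close>

definition ball_volume :: "nat \<Rightarrow> real" where
  "ball_volume d = measure (lborel_Rd d) {x \<in> Rd d. norm2 d x < 1}"

lemma ball_volume_nonneg: "0 \<le> ball_volume d"
  by (simp add: ball_volume_def)

lemma ball_Rd_sets [measurable]: "{x \<in> Rd d. norm2 d x < r} \<in> sets (lborel_Rd d)"
  using measurable_sets[OF measurable_norm2, of "{..<r}" d]
  by (simp add: space_lborel_Rd vimage_def Int_def conj_commute)

text \<open>The enclosing cube [-1, 1]^d makes the measure finite, so that the real number
  \<open>ball_volume d\<close> represents it.\<close>

lemma emeasure_unit_ball_Rd: "emeasure (lborel_Rd d) {x \<in> Rd d. norm2 d x < 1} = ennreal (ball_volume d)"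
proof -
  have "\<bar>x i\<bar> \<le> 1" if "norm2 d x < 1" "i < d" for x i
    using abs_component_le_norm2[OF that(2), of x] that(1) by simp
  then have "\<forall>x. norm2 d x < 1 \<longrightarrow> (\<forall>i<d. -1 \<le> x i \<and> x i \<le> 1)"
    by (simp add: abs_le_iff minus_le_iff)
  then have "{x \<in> Rd d. norm2 d x < 1} \<subseteq> (\<Pi>\<^sub>E i\<in>{..<d}. {-1..1})"
    by (simp add: Rd_def PiE_iff subset_iff)
  then have "emeasure (lborel_Rd d) {x \<in> Rd d. norm2 d x < 1} \<le> emeasure (lborel_Rd d) (\<Pi>\<^sub>E i\<in>{..<d}. {-1..1})"
    by (intro emeasure_mono sets_PiM_I_finite) auto
  also have "\<dots> = (\<Prod>i<d. emeasure lborel {-1..1::real})"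
    by (rule lborel_product.emeasure_PiM) auto
  also have "\<dots> < \<infinity>" by (simp add: power_less_top_ennreal)
  finally show ?thesis unfolding ball_volume_def by (intro emeasure_eq_ennreal_measure) auto
qed

lemma emeasure_ball_Rd:
  assumes "r > 0"
  shows "emeasure (lborel_Rd d) {x \<in> Rd d. norm2 d x < r} = ennreal (r ^ d * ball_volume d)"
proof -
  have "emeasure (lborel_Rd d) {x \<in> Rd d. norm2 d x < r}
    = ennreal (\<bar>r\<bar> ^ d) * (\<integral>\<^sup>+x. indicator {x \<in> Rd d. norm2 d x < r} (affine_Rd d r (\<lambda>_. 0) x) \<partial>lborel_Rd d)"
    using assms by (subst nn_integral_affine_Rd[symmetric]) auto
  also have "(\<integral>\<^sup>+x. indicator {x \<in> Rd d. norm2 d x < r} (affine_Rd d r (\<lambda>_. 0) x) \<partial>lborel_Rd d)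
     = (\<integral>\<^sup>+x. indicator {x \<in> Rd d. norm2 d x < 1} x \<partial>lborel_Rd d)"
    using assms
    by (intro nn_integral_cong)
      (auto simp: scale_Rd_eq_affine[symmetric] norm2_scale_Rd space_lborel_Rd indicator_def)
  finally show ?thesis using assms by (simp add: emeasure_unit_ball_Rd ball_volume_nonneg flip: ennreal_mult)
qed

lemma ball_volume_pos:
  assumes d: "d \<ge> 1"
  shows "ball_volume d > 0"
proof -
  \<comment> \<open>The cube of half-side 1/(2d) fits into the ball: the norm is at most the sum of
    the d absolute coordinates, hence at most 1/2.\<close>
  have "norm2 d x < 1" if "\<And>i. i < d \<Longrightarrow> \<bar>x i\<bar> \<le> 1 / (2 * real d)" for x
  proof -
    have "norm2 d x \<le> (\<Sum>i<d. \<bar>x i\<bar>)" unfolding norm2_def by (rule L2_set_le_sum_abs)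
    also have "\<dots> \<le> (\<Sum>i<d. 1 / (2 * real d))" by (rule sum_mono) (use that in auto)
    also have "\<dots> < 1" using d by simp
    finally show ?thesis .
  qed
  then have "(\<Pi>\<^sub>E i\<in>{..<d}. {-1 / (2 * real d)..1 / (2 * real d)}) \<subseteq> {x \<in> Rd d. norm2 d x < 1}"
    by (fastforce simp: Rd_def PiE_iff abs_le_iff)
  then have "emeasure (lborel_Rd d) (\<Pi>\<^sub>E i\<in>{..<d}. {-1 / (2 * real d)..1 / (2 * real d)}) \<le> ennreal (ball_volume d)"
    unfolding emeasure_unit_ball_Rd[symmetric] by (intro emeasure_mono) auto
  moreover have "emeasure (lborel_Rd d) (\<Pi>\<^sub>E i\<in>{..<d}. {-1 / (2 * real d)..1 / (2 * real d)}) > 0"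
    using d by (subst lborel_product.emeasure_PiM) (auto simp: ennreal_power)
  ultimately have "0 < ennreal (ball_volume d)" by (rule less_le_trans[rotated])
  then show ?thesis by simp
qed

section \<open>Plancherel's identity\<close>

text \<open>The transform without the factor (2 pi)^(-d/2), so Plancherel's identity carries a
  factor (2 pi)^d.\<close>

definition fourier_Rd :: "nat \<Rightarrow> (point \<Rightarrow> real) \<Rightarrow> point \<Rightarrow> complex" where
  "fourier_Rd d f t =
     (\<integral>x. complex_of_real (f x) * exp (- \<i> * complex_of_real (inner_Rd d x t)) \<partial>lborel_Rd d)"

text \<open>A product of integrable functions is integrable on the product space, and so is whatever
  it dominates.\<close>

lemma Fubini_dominated_lborel_Rd:
  fixes k :: "point \<Rightarrow> point \<Rightarrow> complex"
  assumes k [measurable]: "(\<lambda>(x, y). k x y) \<in> borel_measurable (lborel_Rd d \<Otimes>\<^sub>M lborel_Rd d)"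
    and g: "integrable (lborel_Rd d) g" and h: "integrable (lborel_Rd d) h"
    and bound: "\<And>x y. cmod (k x y) \<le> g x * h y"
  shows "(\<integral>x. (\<integral>y. k x y \<partial>lborel_Rd d) \<partial>lborel_Rd d) = (\<integral>y. (\<integral>x. k x y \<partial>lborel_Rd d) \<partial>lborel_Rd d)"
proof -
  interpret pair_sigma_finite "lborel_Rd d" "lborel_Rd d" by (rule pair_sigma_finite_lborel_Rd)
  have [measurable]: "g \<in> borel_measurable (lborel_Rd d)" "h \<in> borel_measurable (lborel_Rd d)"
    using g h by auto
  have gh: "integrable (lborel_Rd d \<Otimes>\<^sub>M lborel_Rd d) (\<lambda>(x, y). g x * h y)"
    by (rule Fubini_integrable) (use g h in \<open>auto simp: abs_mult\<close>)
  have "integrable (lborel_Rd d \<Otimes>\<^sub>M lborel_Rd d) (\<lambda>(x, y). k x y)"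
    by (rule Bochner_Integration.integrable_bound[OF gh k]) (use bound in \<open>auto simp: case_prod_beta intro!: AE_I2 order_trans[OF _ abs_ge_self]\<close>)
  from Fubini_integral[OF this] show ?thesis by simp
qed

text \<open>The characteristic function of the standard normal law at v/s, after substituting z = s
  u. The value is written through \<open>normal_density\<close> so that products over coordinates
  are again probability densities.\<close>

lemma gaussian_fourier_real:
  fixes s v :: real
  assumes "s > 0"
  shows "(\<integral>u. complex_of_real (exp (- (s * u)\<^sup>2 / 2)) * exp (\<i> * complex_of_real (v * u)) \<partial>lborel)
    = complex_of_real (2 * pi * normal_density 0 s v)"
proof -
  have "complex_of_real (exp (- (v / s)\<^sup>2 / 2)) = char std_normal_distribution (v / s)"
    by (simp add: char_std_normal_distribution)
  also have "\<dots> = (\<integral>z. std_normal_density z *\<^sub>R exp (\<i> * complex_of_real (v / s * z)) \<partial>lborel)"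
    unfolding char_def by (subst integral_density) auto
  also have "\<dots> = s *\<^sub>R (\<integral>u. std_normal_density (s * u) *\<^sub>R exp (\<i> * complex_of_real (v / s * (s * u))) \<partial>lborel)"
    using assms by (subst lborel_integral_real_affine[where c=s and t=0]) auto
  also have "\<dots> = s *\<^sub>R (\<integral>u. (1 / sqrt (2 * pi)) *\<^sub>R (complex_of_real (exp (- (s * u)\<^sup>2 / 2)) * exp (\<i> * complex_of_real (v * u))) \<partial>lborel)"
    using assms by (auto simp: std_normal_density_def scaleR_conv_of_real mult_ac)
  also have "\<dots> = complex_of_real (s / sqrt (2 * pi)) * (\<integral>u. complex_of_real (exp (- (s * u)\<^sup>2 / 2)) * exp (\<i> * complex_of_real (v * u)) \<partial>lborel)"
    by (subst integral_scaleR_right) (auto simp: scaleR_conv_of_real)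
  finally have *: "(\<integral>u. complex_of_real (exp (- (s * u)\<^sup>2 / 2)) * exp (\<i> * complex_of_real (v * u)) \<partial>lborel)
     = complex_of_real (sqrt (2 * pi) / s * exp (- (v / s)\<^sup>2 / 2))"
    using assms by (simp add: field_simps)
  have "sqrt (2 * pi) / s * exp (- (v / s)\<^sup>2 / 2) = 2 * pi * normal_density 0 s v"
    using assms by (simp add: normal_density_def real_sqrt_mult field_simps power2_eq_square)
  with * show ?thesis by (simp only:)
qed

definition gauss_weight :: "nat \<Rightarrow> real \<Rightarrow> point \<Rightarrow> real" where
  "gauss_weight d s t = (\<Prod>i<d. exp (- (s * t i)\<^sup>2 / 2))"

text \<open>The density of d independent centred normal variables of standard deviation s; up to (2
  pi)^d it is the transform of \<open>gauss_weight d s\<close>.\<close>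

definition gauss_density :: "nat \<Rightarrow> real \<Rightarrow> point \<Rightarrow> real" where
  "gauss_density d s x = (\<Prod>i<d. normal_density 0 s (x i))"

lemma measurable_gauss [measurable]:
  "gauss_weight d s \<in> borel_measurable (lborel_Rd d)" "gauss_density d s \<in> borel_measurable (lborel_Rd d)"
  unfolding gauss_weight_def gauss_density_def by measurable

lemma gauss_weight_nonneg [simp]: "0 \<le> gauss_weight d s t"
  by (simp add: gauss_weight_def prod_nonneg)

lemma gauss_density_nonneg [simp]: "0 \<le> gauss_density d s t"
  by (simp add: gauss_density_def prod_nonneg)

lemma integrable_gauss_density: "s > 0 \<Longrightarrow> integrable (lborel_Rd d) (gauss_density d s)"
  unfolding gauss_density_def by (rule lborel_product.product_integrable_prod) auto

lemma integral_gauss_density: "s > 0 \<Longrightarrow> integral\<^sup>L (lborel_Rd d) (gauss_density d s) = 1"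
  unfolding gauss_density_def by (subst lborel_product.product_integral_prod) auto

lemma integrable_gaussian:
  fixes s :: real
  assumes "s > 0"
  shows "integrable lborel (\<lambda>x. exp (- (s * x)\<^sup>2 / 2))"
proof -
  have "integrable lborel (\<lambda>x. sqrt (2 * pi * (1 / s)\<^sup>2) * normal_density 0 (1 / s) x)" using assms by simp
  then show ?thesis
    using assms by (simp add: normal_density_def field_simps power2_eq_square)
qed

lemma integrable_gauss_weight:
  assumes "s > 0" shows "integrable (lborel_Rd d) (gauss_weight d s)"
  unfolding gauss_weight_def
  by (intro lborel_product.product_integrable_prod integrable_gaussian assms) simp

text \<open>Weight and exponential both factor over the coordinates, which reduces the integral to a
  product of one-dimensional ones.\<close>

lemma gaussian_fourier:
  assumes "s > 0"
  shows "(\<integral>t. complex_of_real (gauss_weight d s t) * exp (\<i> * complex_of_real (inner_Rd d v t)) \<partial>lborel_Rd d)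
    = complex_of_real ((2 * pi) ^ d * gauss_density d s v)"
proof -
  let ?g = "\<lambda>i u. complex_of_real (exp (- (s * u)\<^sup>2 / 2)) * exp (\<i> * complex_of_real (v i * u))"
  have int: "integrable lborel (?g i)" for i
    by (rule Bochner_Integration.integrable_bound[OF integrable_gaussian[OF assms]]) (auto simp: norm_mult)
  have "complex_of_real (gauss_weight d s t) * exp (\<i> * complex_of_real (inner_Rd d v t)) = (\<Prod>i<d. ?g i (t i))" for t
    by (simp add: gauss_weight_def inner_Rd_def prod.distrib exp_sum sum_distrib_left)
  then have "(\<integral>t. complex_of_real (gauss_weight d s t) * exp (\<i> * complex_of_real (inner_Rd d v t)) \<partial>lborel_Rd d)
     = (\<Prod>i<d. integral\<^sup>L lborel (?g i))"
    using lborel_product.product_integral_prod[of "{..<d}" ?g] int by simp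
  also have "\<dots> = (\<Prod>i<d. complex_of_real (2 * pi * normal_density 0 s (v i)))"
    using gaussian_fourier_real[OF assms] by simp
  finally show ?thesis by (simp add: gauss_density_def prod.distrib)
qed

lemma measurable_inner_Rd_swap [measurable]:
  "(\<lambda>(x, y). inner_Rd d y x) \<in> borel_measurable (lborel_Rd d \<Otimes>\<^sub>M lborel_Rd d)"
  using measurable_inner_Rd_pair by (simp add: inner_Rd_def mult.commute)

lemma measurable_fourier_Rd [measurable]:
  assumes [measurable]: "f \<in> borel_measurable (lborel_Rd d)"
  shows "fourier_Rd d f \<in> borel_measurable (lborel_Rd d)"
  unfolding fourier_Rd_def[abs_def]
  by (rule sigma_finite_measure.borel_measurable_lebesgue_integral[OF sigma_finite_lborel_Rd])
    (use measurable_inner_Rd_swap[of d] in \<open>simp add: case_prod_beta\<close>)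

lemma norm_fourier_Rd_le:
  assumes "integrable (lborel_Rd d) f"
  shows "cmod (fourier_Rd d f t) \<le> (\<integral>x. \<bar>f x\<bar> \<partial>lborel_Rd d)"
  unfolding fourier_Rd_def by (rule order_trans[OF integral_norm_bound]) (simp add: norm_mult)

lemma cnj_fourier_Rd:
  "cnj (fourier_Rd d f t) =
     (\<integral>x. complex_of_real (f x) * exp (\<i> * complex_of_real (inner_Rd d x t)) \<partial>lborel_Rd d)"
  unfolding fourier_Rd_def by (simp add: exp_cnj flip: Bochner_Integration.integral_cnj)

text \<open>For the substitution x = y - s z. It moves the dependence on s from the Gaussian into
  the argument of f, where continuity of f can be used.\<close>

lemma gauss_density_scale:
  assumes "s > 0"
  shows "s ^ d * gauss_density d s (diff_Rd d y (affine_Rd d (- s) y z)) = gauss_density d 1 z"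
proof -
  have "s * normal_density 0 s (s * x) = normal_density 0 1 x" for x
    using assms by (simp add: normal_density_def real_sqrt_mult field_simps)
  then have "(\<Prod>i<d. s * normal_density 0 s (s * z i)) = gauss_density d 1 z"
    by (simp add: gauss_density_def)
  then show ?thesis by (simp add: gauss_density_def diff_Rd_def affine_Rd_def prod.distrib)
qed

text \<open>
  The factor \<open>gauss_weight\<close> makes all the integrals absolutely convergent. Its transform is an
  approximate identity, so letting \<open>s\<close> tend to 0 gives Plancherel's identity.
\<close>

lemma gauss_weighted_plancherel:
  assumes f: "integrable (lborel_Rd d) f" and s: "s > 0"
  shows "(\<integral>t. gauss_weight d s t * (cmod (fourier_Rd d f t))\<^sup>2 \<partial>lborel_Rd d)
    = (2 * pi) ^ d * (\<integral>y. f y * (\<integral>z. f (affine_Rd d (- s) y z) * gauss_density d 1 z \<partial>lborel_Rd d) \<partial>lborel_Rd d)"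
proof -
  have [measurable]: "f \<in> borel_measurable (lborel_Rd d)" using f by auto
  let ?F = "fourier_Rd d f" and ?W = "gauss_weight d s"
  define L where "L = (\<integral>x. \<bar>f x\<bar> \<partial>lborel_Rd d)"
  have L: "cmod (?F t) \<le> L" for t unfolding L_def by (rule norm_fourier_Rd_le[OF f])
  have L0: "L \<ge> 0" using order_trans[OF norm_ge_zero L] .
  have absf: "integrable (lborel_Rd d) (\<lambda>x. \<bar>f x\<bar>)" using f by simp
  have W: "integrable (lborel_Rd d) ?W" using integrable_gauss_weight[OF s] .
  \<comment> \<open>Inverting the weighted transform at y gives the convolution of f with the
    Gaussian density of width s, up to (2 pi)^d.\<close>
  have inner: "(\<integral>t. of_real (?W t) * ?F t * (of_real (f y) * exp (\<i> * complex_of_real (inner_Rd d y t))) \<partial>lborel_Rd d)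
     = complex_of_real ((2 * pi) ^ d * (f y * (\<integral>z. f (affine_Rd d (- s) y z) * gauss_density d 1 z \<partial>lborel_Rd d)))" for y
  proof -
    let ?k = "\<lambda>t x. of_real (?W t) * (of_real (f x) * exp (- \<i> * complex_of_real (inner_Rd d x t))) *
        exp (\<i> * complex_of_real (inner_Rd d y t))"
    have e: "?k t x = of_real (f x) * (of_real (?W t) * exp (\<i> * complex_of_real (inner_Rd d (diff_Rd d y x) t)))" for t x
    proof -
      have "inner_Rd d (diff_Rd d y x) t = inner_Rd d y t - inner_Rd d x t"
        by (simp add: inner_Rd_def diff_Rd_def sum_subtractf algebra_simps)
      then have "exp (\<i> * complex_of_real (inner_Rd d (diff_Rd d y x) t)) =
         exp (- \<i> * complex_of_real (inner_Rd d x t)) * exp (\<i> * complex_of_real (inner_Rd d y t))"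
        by (simp only: mult_exp_exp) (simp add: algebra_simps)
      then show ?thesis by (simp add: mult_ac)
    qed
    have "(\<integral>t. of_real (?W t) * ?F t * exp (\<i> * complex_of_real (inner_Rd d y t)) \<partial>lborel_Rd d)
      = (\<integral>t. (\<integral>x. ?k t x \<partial>lborel_Rd d) \<partial>lborel_Rd d)"
      by (simp add: fourier_Rd_def)
    also have "\<dots> = (\<integral>x. (\<integral>t. ?k t x \<partial>lborel_Rd d) \<partial>lborel_Rd d)"
    proof (rule Fubini_dominated_lborel_Rd[OF _ W absf])
      show "(\<lambda>(t, x). ?k t x) \<in> borel_measurable (lborel_Rd d \<Otimes>\<^sub>M lborel_Rd d)"
        using measurable_inner_Rd_swap[of d] by (simp add: case_prod_beta)
    qed (auto simp: norm_mult)
    also have "\<dots> = (\<integral>x. complex_of_real (f x * ((2 * pi) ^ d * gauss_density d s (diff_Rd d y x))) \<partial>lborel_Rd d)"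
      unfolding e by (subst integral_mult_right_zero) (simp only: gaussian_fourier[OF s] of_real_mult)
    also have "\<dots> = complex_of_real (\<integral>x. f x * ((2 * pi) ^ d * gauss_density d s (diff_Rd d y x)) \<partial>lborel_Rd d)"
      by (rule integral_complex_of_real)
    also have "(\<integral>x. f x * ((2 * pi) ^ d * gauss_density d s (diff_Rd d y x)) \<partial>lborel_Rd d)
       = (2 * pi) ^ d * (\<integral>x. f x * gauss_density d s (diff_Rd d y x) \<partial>lborel_Rd d)"
      by (subst integral_mult_right_zero[symmetric]) (simp add: mult_ac)
    also have "(\<integral>x. f x * gauss_density d s (diff_Rd d y x) \<partial>lborel_Rd d)
       = s ^ d * (\<integral>z. f (affine_Rd d (- s) y z) * gauss_density d s (diff_Rd d y (affine_Rd d (- s) y z)) \<partial>lborel_Rd d)"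
      using s by (subst integral_affine_Rd[where c="-s" and a=y]) (auto simp: diff_Rd_eq_affine)
    also have "\<dots> = (\<integral>z. f (affine_Rd d (- s) y z) * gauss_density d 1 z \<partial>lborel_Rd d)"
      unfolding gauss_density_scale[OF s, of d y, symmetric]
      by (simp only: integral_mult_right_zero[symmetric] mult.left_commute)
    finally have "(\<integral>t. of_real (?W t) * ?F t * exp (\<i> * complex_of_real (inner_Rd d y t)) \<partial>lborel_Rd d) =
       complex_of_real ((2 * pi) ^ d * (\<integral>z. f (affine_Rd d (- s) y z) * gauss_density d 1 z \<partial>lborel_Rd d))" .
    moreover have "(\<integral>t. of_real (?W t) * ?F t * (of_real (f y) * exp (\<i> * complex_of_real (inner_Rd d y t))) \<partial>lborel_Rd d) =
       of_real (f y) * (\<integral>t. of_real (?W t) * ?F t * exp (\<i> * complex_of_real (inner_Rd d y t)) \<partial>lborel_Rd d)"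
      by (subst integral_mult_right_zero[symmetric]) (simp add: mult_ac)
    ultimately show ?thesis by simp
  qed
  have "complex_of_real (\<integral>t. ?W t * (cmod (?F t))\<^sup>2 \<partial>lborel_Rd d) = (\<integral>t. of_real (?W t) * ?F t * cnj (?F t) \<partial>lborel_Rd d)"
    by (subst integral_complex_of_real[symmetric]) (simp only: of_real_mult complex_norm_square mult.assoc)
  also have "\<dots> = (\<integral>t. (\<integral>y. of_real (?W t) * ?F t * (of_real (f y) * exp (\<i> * complex_of_real (inner_Rd d y t))) \<partial>lborel_Rd d) \<partial>lborel_Rd d)"
    by (simp only: cnj_fourier_Rd integral_mult_right_zero)
  also have "\<dots> = (\<integral>y. (\<integral>t. of_real (?W t) * ?F t * (of_real (f y) * exp (\<i> * complex_of_real (inner_Rd d y t))) \<partial>lborel_Rd d) \<partial>lborel_Rd d)"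
  \<comment> \<open>The transform is bounded by the L1 norm \<open>L\<close> of f, so the weight
    alone provides integrability in t.\<close>
  proof (rule Fubini_dominated_lborel_Rd[where g="\<lambda>t. L * ?W t", OF _ _ absf])
    show "(\<lambda>(t, y). of_real (?W t) * ?F t * (of_real (f y) * exp (\<i> * complex_of_real (inner_Rd d y t)))) \<in> borel_measurable (lborel_Rd d \<Otimes>\<^sub>M lborel_Rd d)"
      using measurable_inner_Rd_swap[of d] by (simp add: case_prod_beta)
    show "cmod (of_real (?W t) * ?F t * (of_real (f y) * exp (\<i> * complex_of_real (inner_Rd d y t)))) \<le> L * ?W t * \<bar>f y\<bar>" for t y
      using mult_right_mono[OF mult_left_mono[OF L[of t], of "?W t"], of "\<bar>f y\<bar>"] by (simp add: norm_mult mult_ac)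
  qed (use W in simp)
  also have "\<dots> = complex_of_real ((2 * pi) ^ d * (\<integral>y. f y * (\<integral>z. f (affine_Rd d (- s) y z) * gauss_density d 1 z \<partial>lborel_Rd d) \<partial>lborel_Rd d))"
    unfolding inner by (subst integral_complex_of_real) simp
  finally show ?thesis by (simp only: of_real_eq_iff)
qed

text \<open>Continuity is asked for in the form that the averages over x - s z consume, along s =
  1/(n+1) for fixed x and z. The side of f converges by domination, using boundedness of f. On the
  transform side the weights increase to 1, so monotone convergence yields the integral together
  with the integrability of the squared modulus.\<close>

lemma plancherel_Rd:
  assumes f: "integrable (lborel_Rd d) f" and K: "\<And>x. \<bar>f x\<bar> \<le> K"
    and cont: "\<And>x z. x \<in> Rd d \<Longrightarrow> (\<lambda>n. f (affine_Rd d (- (1 / real (Suc n))) x z)) \<longlonglongrightarrow> f x"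
  shows "has_bochner_integral (lborel_Rd d) (\<lambda>t. (cmod (fourier_Rd d f t))\<^sup>2)
     ((2 * pi) ^ d * (\<integral>x. (f x)\<^sup>2 \<partial>lborel_Rd d))"
proof -
  have [measurable]: "f \<in> borel_measurable (lborel_Rd d)" using f by auto
  have K0: "K \<ge> 0" using order_trans[OF abs_ge_zero K] .
  let ?s = "\<lambda>n. 1 / real (Suc n)"
  let ?I = "\<lambda>n y. \<integral>z. f (affine_Rd d (- ?s n) y z) * gauss_density d 1 z \<partial>lborel_Rd d"
  have bnd: "norm (f (affine_Rd d (- ?s n) y z) * gauss_density d 1 z) \<le> K * gauss_density d 1 z" for n y z
    using K by (auto simp: abs_mult intro!: mult_right_mono)
  have gi: "integrable (lborel_Rd d) (\<lambda>z. K * gauss_density d 1 z)" using integrable_gauss_density by simp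
  have inner: "(\<lambda>n. ?I n y) \<longlonglongrightarrow> f y" if y: "y \<in> Rd d" for y
  proof -
    have "(\<lambda>n. ?I n y) \<longlonglongrightarrow> (\<integral>z. f y * gauss_density d 1 z \<partial>lborel_Rd d)"
    proof (rule integral_dominated_convergence[OF _ _ gi])
      show "AE z in lborel_Rd d. (\<lambda>n. f (affine_Rd d (- ?s n) y z) * gauss_density d 1 z) \<longlonglongrightarrow> f y * gauss_density d 1 z"
        by (intro AE_I2 tendsto_mult cont[OF y] tendsto_const)
      show "AE z in lborel_Rd d. norm (f (affine_Rd d (- ?s n) y z) * gauss_density d 1 z) \<le> K * gauss_density d 1 z" for n
        by (intro AE_I2 bnd)
    qed measurable
    then show ?thesis by (simp add: integral_gauss_density)
  qed
  have Ibnd: "\<bar>?I n y\<bar> \<le> K" for n y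
  proof -
    have "norm (?I n y) \<le> (\<integral>z. K * gauss_density d 1 z \<partial>lborel_Rd d)"
      by (rule order_trans[OF integral_norm_bound], rule integral_mono)
        (use bnd gi in \<open>auto intro!: Bochner_Integration.integrable_bound[OF gi] AE_I2 order_trans[OF _ abs_ge_self]\<close>)
    then show ?thesis by (simp add: integral_gauss_density)
  qed
  have Imeas: "?I n \<in> borel_measurable (lborel_Rd d)" for n
  proof (rule sigma_finite_measure.borel_measurable_lebesgue_integral[OF sigma_finite_lborel_Rd])
    show "(\<lambda>(y, z). f (affine_Rd d (- ?s n) y z) * gauss_density d 1 z) \<in> borel_measurable (lborel_Rd d \<Otimes>\<^sub>M lborel_Rd d)"
      using measurable_affine_Rd_pair[of d "- ?s n"] by (simp add: case_prod_beta)
  qed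
  have "(\<lambda>n. \<integral>y. f y * ?I n y \<partial>lborel_Rd d) \<longlonglongrightarrow> (\<integral>y. f y * f y \<partial>lborel_Rd d)"
  proof (rule integral_dominated_convergence[where w="\<lambda>y. \<bar>f y\<bar> * K"])
    show "AE y in lborel_Rd d. (\<lambda>n. f y * ?I n y) \<longlonglongrightarrow> f y * f y"
      by (rule AE_I2) (auto simp: space_lborel_Rd simp del: of_nat_Suc intro!: tendsto_mult inner)
    show "AE y in lborel_Rd d. norm (f y * ?I n y) \<le> \<bar>f y\<bar> * K" for n
      using Ibnd by (auto simp: abs_mult intro!: mult_left_mono)
  qed (use f Imeas in auto)
  then have lim: "(\<lambda>n. \<integral>t. gauss_weight d (?s n) t * (cmod (fourier_Rd d f t))\<^sup>2 \<partial>lborel_Rd d)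
      \<longlonglongrightarrow> (2 * pi) ^ d * (\<integral>x. (f x)\<^sup>2 \<partial>lborel_Rd d)"
    by (subst gauss_weighted_plancherel[OF f]) (auto simp: power2_eq_square intro!: tendsto_mult)
  have mono: "gauss_weight d (?s n) t \<le> gauss_weight d (?s m) t" if "n \<le> m" for n m t
    unfolding gauss_weight_def
  proof (intro prod_mono conjI)
    fix i
    have "(?s m)\<^sup>2 \<le> (?s n)\<^sup>2" using that by (intro power_mono) (auto simp: field_simps)
    then have "(?s m * t i)\<^sup>2 \<le> (?s n * t i)\<^sup>2" unfolding power_mult_distrib by (intro mult_right_mono) auto
    then show "exp (- (?s n * t i)\<^sup>2 / 2) \<le> exp (- (?s m * t i)\<^sup>2 / 2)" by simp
  qed simp
  have tend: "(\<lambda>n. gauss_weight d (?s n) t) \<longlonglongrightarrow> 1" for t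
  proof -
    have "(\<lambda>n. gauss_weight d (?s n) t) \<longlonglongrightarrow> (\<Prod>i<d. exp (- (0 * t i)\<^sup>2 / 2))"
      unfolding gauss_weight_def by (intro tendsto_intros LIMSEQ_Suc[OF lim_1_over_n]) simp
    then show ?thesis by simp
  qed
  define L where "L = (\<integral>x. \<bar>f x\<bar> \<partial>lborel_Rd d)"
  have L: "(cmod (fourier_Rd d f t))\<^sup>2 \<le> L\<^sup>2" for t
    unfolding L_def by (intro power_mono norm_fourier_Rd_le[OF f]) simp
  show ?thesis
  proof (rule has_bochner_integral_monotone_convergence[OF _ _ _ lim])
    show "integrable (lborel_Rd d) (\<lambda>t. gauss_weight d (?s n) t * (cmod (fourier_Rd d f t))\<^sup>2)" for n
      by (rule Bochner_Integration.integrable_bound[where f="\<lambda>t. gauss_weight d (?s n) t * L\<^sup>2"])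
        (use integrable_gauss_weight[of "?s n" d] L in \<open>auto simp: abs_mult intro!: mult_left_mono\<close>)
    show "AE t in lborel_Rd d. mono (\<lambda>n. gauss_weight d (?s n) t * (cmod (fourier_Rd d f t))\<^sup>2)"
      by (intro AE_I2 monoI mult_right_mono mono) auto
    show "AE t in lborel_Rd d. (\<lambda>n. gauss_weight d (?s n) t * (cmod (fourier_Rd d f t))\<^sup>2) \<longlonglongrightarrow> (cmod (fourier_Rd d f t))\<^sup>2"
      using tendsto_mult[OF tend tendsto_const] by (intro AE_I2) simp
  qed measurable
qed

section \<open>The energy of the bump\<close>

text \<open>The bump without its normalising constant, written with \<open>max\<close> so that
  Lipschitz estimates are immediate.\<close>

definition paraboloid :: "nat \<Rightarrow> point \<Rightarrow> real" where
  "paraboloid d x = max 0 (1 - (norm2 d x)\<^sup>2)"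

lemma norm2_sq_less_1 [simp]: "(norm2 d x)\<^sup>2 < 1 \<longleftrightarrow> norm2 d x < 1"
  using abs_square_less_1[of "norm2 d x"] by simp

lemma bump_eq_paraboloid: "bump d C x = sqrt C * paraboloid d x"
  using norm2_sq_less_1[of d x] by (auto simp: bump_def paraboloid_def max_def simp del: norm2_sq_less_1)

lemma paraboloid_bounds: "0 \<le> paraboloid d x" "paraboloid d x \<le> 1" "norm2 d x \<ge> 1 \<Longrightarrow> paraboloid d x = 0"
  using norm2_sq_less_1[of d x] by (auto simp: paraboloid_def simp del: norm2_sq_less_1)

lemma measurable_paraboloid [measurable]: "paraboloid d \<in> borel_measurable (lborel_Rd d)"
  unfolding paraboloid_def by measurable

lemma integrable_unit_ball: "integrable (lborel_Rd d) (indicator {x \<in> Rd d. norm2 d x < 1} :: point \<Rightarrow> real)"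
  by (rule integrable_real_indicator) (auto simp: emeasure_unit_ball_Rd)

lemma integrable_paraboloid: "integrable (lborel_Rd d) (paraboloid d)"
proof (rule Bochner_Integration.integrable_bound[OF integrable_unit_ball])
  show "AE x in lborel_Rd d. norm (paraboloid d x) \<le> norm (indicator {x \<in> Rd d. norm2 d x < 1} x :: real)"
    by (rule AE_I2) (simp add: space_lborel_Rd indicator_def paraboloid_bounds not_less)
qed measurable

lemma integrable_paraboloid_sq: "integrable (lborel_Rd d) (\<lambda>x. (paraboloid d x)\<^sup>2)"
  by (rule Bochner_Integration.integrable_bound[OF integrable_paraboloid])
    (use paraboloid_bounds in \<open>auto simp: power2_eq_square mult_left_le\<close>)

lemma tendsto_paraboloid:
  assumes "\<And>i. i < d \<Longrightarrow> (\<lambda>n. X n i) \<longlonglongrightarrow> x i"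
  shows "(\<lambda>n. paraboloid d (X n)) \<longlonglongrightarrow> paraboloid d x"
  unfolding paraboloid_def norm2_sq by (intro tendsto_intros assms) auto

definition paraboloid_mass :: "nat \<Rightarrow> real" where
  "paraboloid_mass d = (\<integral>x. (paraboloid d x)\<^sup>2 \<partial>lborel_Rd d)"

text \<open>
  Half of the unit ball lies at norm at most \<open>1 - 1 / (2 * d)\<close>, by Bernoulli's inequality, and the
  paraboloid is at least \<open>1 / (2 * d)\<close> there.
\<close>

lemma paraboloid_mass_ge:
  assumes d: "d \<ge> 1"
  shows "ball_volume d / (8 * (real d)\<^sup>2) \<le> paraboloid_mass d"
proof -
  define r where "r = 1 - 1 / (2 * real d)"
  have r: "r > 0" "r < 1" using d by (auto simp: r_def field_simps)
  have "1 / 2 = 1 + real d * (- 1 / (2 * real d))" using d by simp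
  also have "\<dots> \<le> (1 + (- 1 / (2 * real d))) ^ d"
    by (rule Bernoulli_inequality) (use d in \<open>auto simp: field_simps\<close>)
  also have "\<dots> = r ^ d" by (simp add: r_def)
  finally have rd: "1 / 2 \<le> r ^ d" .
  let ?S = "{x \<in> Rd d. norm2 d x < r}"
  have "paraboloid d x \<ge> 1 / (2 * real d)" if "x \<in> ?S" for x
  proof -
    have "(norm2 d x)\<^sup>2 \<le> norm2 d x"
      using that r by (simp add: power2_eq_square mult_left_le)
    moreover have "norm2 d x < r" using that by simp
    ultimately have "1 / (2 * real d) \<le> 1 - (norm2 d x)\<^sup>2" unfolding r_def by linarith
    then show ?thesis by (simp only: paraboloid_def max.coboundedI2)
  qed
  then have le: "(1 / (2 * real d))\<^sup>2 * indicator ?S x \<le> (paraboloid d x)\<^sup>2" for x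
    by (auto simp: indicator_def simp del: power_divide intro!: power_mono)
  have fin: "emeasure (lborel_Rd d) ?S = ennreal (r ^ d * ball_volume d)" by (rule emeasure_ball_Rd[OF r(1)])
  \<comment> \<open>The 8 is 4 from squaring the height 1/(2d), times 2 from keeping half of the
    volume.\<close>
  have "ball_volume d / (8 * (real d)\<^sup>2) = (1 / (2 * real d))\<^sup>2 * (1 / 2 * ball_volume d)"
    by (simp add: power2_eq_square)
  also have "\<dots> \<le> (1 / (2 * real d))\<^sup>2 * (r ^ d * ball_volume d)"
    using rd ball_volume_pos[OF d] by (intro mult_left_mono mult_right_mono) auto
  also have "\<dots> = (1 / (2 * real d))\<^sup>2 * measure (lborel_Rd d) ?S"
    using fin r ball_volume_pos[OF d] by (simp add: measure_def)
  also have "\<dots> = (\<integral>x. (1 / (2 * real d))\<^sup>2 * indicator ?S x \<partial>lborel_Rd d)"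
    by (simp add: space_lborel_Rd Int_absorb1 Int_def conj_commute cong: conj_cong)
  also have "\<dots> \<le> paraboloid_mass d"
    unfolding paraboloid_mass_def
    by (rule integral_mono[OF _ integrable_paraboloid_sq le]) (auto simp: fin intro!: integrable_real_indicator)
  finally show ?thesis .
qed

lemma paraboloid_mass_pos: "d \<ge> 1 \<Longrightarrow> paraboloid_mass d > 0"
  by (rule less_le_trans[OF _ paraboloid_mass_ge]) (use ball_volume_pos[of d] in auto)

text \<open>For positive C the squared norm of the bump is linear in C, so exactly one C meets the
  description.\<close>

lemma C_const_eq:
  assumes d: "d \<ge> 1"
  shows "C_const d = 1 / paraboloid_mass d"
  unfolding C_const_def
proof (rule the_equality)
  have *: "(\<integral>x. \<bar>bump d C x\<bar>\<^sup>2 \<partial>lebesgue_Rd d) = C * paraboloid_mass d" if "C > 0" for C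
    unfolding lebesgue_Rd_def paraboloid_mass_def bump_eq_paraboloid
    using that by (subst integral_completion) (auto simp: power_mult_distrib)
  show "1 / paraboloid_mass d > 0 \<and> sqrt (\<integral>x. \<bar>bump d (1 / paraboloid_mass d) x\<bar>\<^sup>2 \<partial>lebesgue_Rd d) = 1"
    using * paraboloid_mass_pos[OF d] by simp
  fix C assume "C > 0 \<and> sqrt (\<integral>x. \<bar>bump d C x\<bar>\<^sup>2 \<partial>lebesgue_Rd d) = 1"
  then have "C * paraboloid_mass d = 1" using *[of C] by auto
  then show "C = 1 / paraboloid_mass d" using paraboloid_mass_pos[OF d] by (simp add: field_simps)
qed

section \<open>Finite differences of the paraboloid\<close>

definition shift_Rd :: "nat \<Rightarrow> nat \<Rightarrow> real \<Rightarrow> point \<Rightarrow> point" where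
  "shift_Rd d j h = affine_Rd d 1 (\<lambda>i. if i = j then h else 0)"

lemma norm2_sq_shift:
  assumes "j < d"
  shows "(norm2 d (shift_Rd d j h x))\<^sup>2 = (norm2 d x)\<^sup>2 + 2 * h * x j + h\<^sup>2"
proof -
  have "(norm2 d (shift_Rd d j h x))\<^sup>2 = (\<Sum>i<d. (x i)\<^sup>2 + (if i = j then 2 * h * x j + h\<^sup>2 else 0))"
    unfolding norm2_sq by (rule sum.cong) (auto simp: shift_Rd_def affine_Rd_def power2_eq_square algebra_simps)
  then show ?thesis using assms by (simp add: sum.distrib norm2_sq)
qed

text \<open>
  Since \<open>max 0\<close> is 1-Lipschitz, the kink of the paraboloid on the unit sphere costs nothing.
\<close>

lemma paraboloid_difference:
  assumes j: "j < d" and h: "0 < h"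
  shows "(paraboloid d (shift_Rd d j h x) - paraboloid d x)\<^sup>2
    \<le> h\<^sup>2 * (8 * (x j)\<^sup>2 + 2 * h\<^sup>2) * (if norm2 d x < 1 + h then 1 else 0)"
proof (cases "norm2 d x < 1 + h")
  case True
  have "\<bar>paraboloid d (shift_Rd d j h x) - paraboloid d x\<bar> \<le> \<bar>2 * h * x j + h\<^sup>2\<bar>"
    unfolding paraboloid_def norm2_sq_shift[OF j] by auto
  then have "(paraboloid d (shift_Rd d j h x) - paraboloid d x)\<^sup>2 \<le> (2 * h * x j + h\<^sup>2)\<^sup>2"
    by (simp only: abs_le_square_iff)
  also have "\<dots> = h\<^sup>2 * (2 * x j + h)\<^sup>2" by (simp add: power2_eq_square algebra_simps)
  also have "\<dots> \<le> h\<^sup>2 * (8 * (x j)\<^sup>2 + 2 * h\<^sup>2)"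
  proof (rule mult_left_mono)
    \<comment> \<open>The right side minus the left side below is exactly this square.\<close>
    have "0 \<le> (2 * x j - h)\<^sup>2" by simp
    then show "(2 * x j + h)\<^sup>2 \<le> 8 * (x j)\<^sup>2 + 2 * h\<^sup>2" by (simp add: power2_eq_square algebra_simps)
  qed simp
  finally show ?thesis using True by simp
next
  case False
  \<comment> \<open>A shift by h lowers the norm by at most h, so both points lie outside the open
    unit ball.\<close>
  have "1 \<le> (norm2 d x - h)\<^sup>2" using False by (simp add: one_le_power)
  also have "\<dots> = (norm2 d x)\<^sup>2 - 2 * h * norm2 d x + h\<^sup>2" by (simp add: power2_eq_square algebra_simps)
  also have "\<dots> \<le> (norm2 d x)\<^sup>2 + 2 * h * x j + h\<^sup>2"
    using mult_left_mono[of "- norm2 d x" "x j" "2 * h"] abs_component_le_norm2[OF j, of x] h by auto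
  finally have "paraboloid d (shift_Rd d j h x) = 0"
    unfolding paraboloid_def norm2_sq_shift[OF j] by simp
  moreover have "paraboloid d x = 0" using False h by (intro paraboloid_bounds) simp
  ultimately show ?thesis by simp
qed

lemma integrable_difference_paraboloid:
  "integrable (lborel_Rd d) (\<lambda>x. paraboloid d (shift_Rd d j h x) - paraboloid d x)"
  unfolding shift_Rd_def
  by (intro Bochner_Integration.integrable_diff integrable_affine_Rd integrable_paraboloid) simp

lemma abs_difference_paraboloid: "\<bar>paraboloid d y - paraboloid d x\<bar> \<le> 1"
  using paraboloid_bounds[of d x] paraboloid_bounds[of d y] by linarith

text \<open>Summing \<open>paraboloid_difference\<close> over j turns the squared coordinates into
  the squared norm, which is at most 4 because 1 + h \<le> 2. With d h^2 \<le> 1 the factor is 8 * 4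
  + 2 = 34. The supporting ball has volume (1 + h)^d \<le> e \<le> 3 times that of the unit ball,
  and 34 * 3 = 102.\<close>

lemma difference_quotient_energy:
  assumes d: "d \<ge> 1" and h: "0 < h" "h \<le> 1 / real d"
  shows "(\<Sum>j<d. \<integral>x. (paraboloid d (shift_Rd d j h x) - paraboloid d x)\<^sup>2 \<partial>lborel_Rd d)
    \<le> 102 * h\<^sup>2 * ball_volume d"
proof -
  let ?D = "\<lambda>j x. paraboloid d (shift_Rd d j h x) - paraboloid d x"
  let ?S = "{x \<in> Rd d. norm2 d x < 1 + h}"
  have h1: "h \<le> 1" using h d by (auto intro: order_trans)
  have int: "integrable (lborel_Rd d) (\<lambda>x. (?D j x)\<^sup>2)" for j
  proof (rule Bochner_Integration.integrable_bound[OF integrable_difference_paraboloid[of d j h]])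
    show "AE x in lborel_Rd d. norm ((?D j x)\<^sup>2) \<le> norm (?D j x)"
      unfolding power2_eq_square real_norm_def abs_mult
      by (intro AE_I2 mult_left_le abs_difference_paraboloid abs_ge_zero)
  qed (unfold shift_Rd_def, measurable)
  have pw: "(\<Sum>j<d. (?D j x)\<^sup>2) \<le> 34 * h\<^sup>2 * indicator ?S x" if "x \<in> Rd d" for x
  proof (cases "norm2 d x < 1 + h")
    case True
    have "(\<Sum>j<d. (?D j x)\<^sup>2) \<le> (\<Sum>j<d. h\<^sup>2 * (8 * (x j)\<^sup>2 + 2 * h\<^sup>2))"
      using paraboloid_difference[OF _ h(1), of _ d x] True by (intro sum_mono) auto
    also have "\<dots> = h\<^sup>2 * (8 * (norm2 d x)\<^sup>2 + 2 * (real d * h\<^sup>2))"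
      by (simp add: norm2_sq sum_distrib_left sum.distrib algebra_simps)
    also have "\<dots> \<le> h\<^sup>2 * 34"
    proof (rule mult_left_mono)
      have "(norm2 d x)\<^sup>2 \<le> 2\<^sup>2" by (rule power_mono) (use True h1 in auto)
      moreover have "(real d * h) * h \<le> 1 * 1" by (rule mult_mono) (use h h1 d in \<open>auto simp: field_simps\<close>)
      ultimately show "8 * (norm2 d x)\<^sup>2 + 2 * (real d * h\<^sup>2) \<le> 34" by (simp add: power2_eq_square mult_ac)
    qed simp
    finally show ?thesis using True that by simp
  next
    case False
    then have "(?D j x)\<^sup>2 \<le> 0" if "j < d" for j using paraboloid_difference[OF that h(1), of x] by simp
    then have "(\<Sum>j<d. (?D j x)\<^sup>2) \<le> 0" by (intro sum_nonpos) auto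
    then show ?thesis using h by (simp add: order_trans)
  qed
  have S: "emeasure (lborel_Rd d) ?S = ennreal ((1 + h) ^ d * ball_volume d)"
    using h by (intro emeasure_ball_Rd) simp
  have exp: "(1 + h) ^ d \<le> 3"
  proof -
    have "(1 + h) ^ d \<le> exp h ^ d" using h by (intro power_mono exp_ge_add_one_self) auto
    also have "\<dots> = exp (real d * h)" by (simp add: exp_of_nat_mult)
    also have "\<dots> \<le> exp 1" using h d by (simp add: field_simps)
    also have "\<dots> \<le> 3" by (rule exp_le)
    finally show ?thesis .
  qed
  have "(\<Sum>j<d. \<integral>x. (?D j x)\<^sup>2 \<partial>lborel_Rd d) = (\<integral>x. (\<Sum>j<d. (?D j x)\<^sup>2) \<partial>lborel_Rd d)"
    by (rule Bochner_Integration.integral_sum[symmetric]) (rule int)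
  also have "\<dots> \<le> (\<integral>x. 34 * h\<^sup>2 * indicator ?S x \<partial>lborel_Rd d)"
    by (rule integral_mono) (use int pw in \<open>auto simp: S space_lborel_Rd intro!: integrable_real_indicator\<close>)
  also have "\<dots> = 34 * h\<^sup>2 * measure (lborel_Rd d) ?S"
    by (simp add: space_lborel_Rd Int_absorb1 Int_def conj_commute cong: conj_cong)
  also have "\<dots> = 34 * h\<^sup>2 * ((1 + h) ^ d * ball_volume d)"
    using S h ball_volume_pos[OF d] by (simp add: measure_def)
  also have "\<dots> \<le> 34 * h\<^sup>2 * (3 * ball_volume d)"
    using exp ball_volume_pos[OF d] by (intro mult_left_mono mult_right_mono) auto
  finally show ?thesis by simp
qed

section \<open>The kernel and its second moment\<close>

lemma fourier_shift_Rd: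
  assumes j: "j < d" and [measurable]: "f \<in> borel_measurable (lborel_Rd d)"
  shows "fourier_Rd d (\<lambda>x. f (shift_Rd d j h x)) t = exp (\<i> * complex_of_real (h * t j)) * fourier_Rd d f t"
proof -
  have "inner_Rd d (shift_Rd d j h x) t = inner_Rd d x t + h * t j" for x
  proof -
    have "inner_Rd d (shift_Rd d j h x) t = (\<Sum>i<d. x i * t i + (if i = j then h * t j else 0))"
      unfolding inner_Rd_def by (rule sum.cong) (auto simp: shift_Rd_def affine_Rd_def algebra_simps)
    then show ?thesis using j by (simp add: sum.distrib inner_Rd_def)
  qed
  then have e: "exp (\<i> * complex_of_real (h * t j)) * (complex_of_real (f (shift_Rd d j h x)) *
      exp (- \<i> * complex_of_real (inner_Rd d (shift_Rd d j h x) t)))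
    = complex_of_real (f (shift_Rd d j h x)) * exp (- \<i> * complex_of_real (inner_Rd d x t))" for x
    by (simp add: mult.left_commute mult_exp_exp algebra_simps)
  have "fourier_Rd d f t = (\<integral>x. complex_of_real (f (shift_Rd d j h x)) *
      exp (- \<i> * complex_of_real (inner_Rd d (shift_Rd d j h x) t)) \<partial>lborel_Rd d)"
    unfolding fourier_Rd_def shift_Rd_def by (subst integral_affine_Rd[where c=1]) auto
  then show ?thesis unfolding fourier_Rd_def[of d "\<lambda>x. f (shift_Rd d j h x)"] e[symmetric] by simp
qed

lemma fourier_difference_paraboloid:
  assumes "j < d"
  shows "fourier_Rd d (\<lambda>x. paraboloid d (shift_Rd d j h x) - paraboloid d x) t
    = (exp (\<i> * complex_of_real (h * t j)) - 1) * fourier_Rd d (paraboloid d) t"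
proof -
  have int: "integrable (lborel_Rd d) (\<lambda>x. complex_of_real (f x) * exp (- \<i> * complex_of_real (inner_Rd d x t)))"
    if "integrable (lborel_Rd d) f" for f
    by (rule Bochner_Integration.integrable_bound[OF that]) (use that in \<open>auto simp: norm_mult\<close>)
  have "integrable (lborel_Rd d) (\<lambda>x. paraboloid d (shift_Rd d j h x))"
    unfolding shift_Rd_def by (intro integrable_affine_Rd integrable_paraboloid) simp
  then have "fourier_Rd d (\<lambda>x. paraboloid d (shift_Rd d j h x) - paraboloid d x) t
     = fourier_Rd d (\<lambda>x. paraboloid d (shift_Rd d j h x)) t - fourier_Rd d (paraboloid d) t"
    unfolding fourier_Rd_def of_real_diff left_diff_distrib
    by (intro Bochner_Integration.integral_diff int integrable_paraboloid)
  then show ?thesis by (simp add: fourier_shift_Rd[OF assms] algebra_simps)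
qed

text \<open>\<open>B\<close> as a visibly nonnegative real function: (2 pi)^d comes from squaring
  the prefactor of \<open>b_hat\<close>, and \<open>paraboloid_mass d\<close> is the inverse of
  \<open>C_const d\<close>.\<close>

definition B_density :: "nat \<Rightarrow> point \<Rightarrow> real" where
  "B_density d t = (cmod (fourier_Rd d (paraboloid d) t))\<^sup>2 / ((2 * pi) ^ d * paraboloid_mass d)"

lemma measurable_B_density [measurable]: "B_density d \<in> borel_measurable (lborel_Rd d)"
  unfolding B_density_def by measurable

lemma B_density_nonneg: "d \<ge> 1 \<Longrightarrow> 0 \<le> B_density d t"
  using paraboloid_mass_pos[of d] by (simp add: B_density_def)

text \<open>The paraboloid is even, so the reflection x -> -x undoes the conjugation. Hence the
  plain square defining \<open>B\<close> equals the squared modulus.\<close>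

lemma fourier_paraboloid_real: "cnj (fourier_Rd d (paraboloid d) t) = fourier_Rd d (paraboloid d) t"
proof -
  have n: "norm2 d (affine_Rd d (-1) (\<lambda>_. 0) x) = norm2 d x" for x
    using norm2_scale_Rd[of d "-1" x] by (simp add: scale_Rd_eq_affine)
  have i: "inner_Rd d (affine_Rd d (-1) (\<lambda>_. 0) x) t = - inner_Rd d x t" for x
    by (simp add: inner_Rd_def affine_Rd_def sum_negf)
  show ?thesis
    unfolding cnj_fourier_Rd unfolding fourier_Rd_def
    by (subst integral_affine_Rd[where c="-1" and a="\<lambda>_. 0"]) (auto simp: paraboloid_def n i)
qed

lemma B_eq_B_density:
  assumes d: "d \<ge> 1"
  shows "B d t = complex_of_real (B_density d t)"
proof -
  let ?F = "fourier_Rd d (paraboloid d) t"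
  have "(\<integral>x. complex_of_real (b d x) * exp (- \<i> * complex_of_real (inner_Rd d x t)) \<partial>lebesgue_Rd d)
     = (\<integral>x. complex_of_real (sqrt (C_const d)) * (complex_of_real (paraboloid d x) * exp (- \<i> * complex_of_real (inner_Rd d x t))) \<partial>lborel_Rd d)"
    unfolding lebesgue_Rd_def b_def bump_eq_paraboloid by (subst integral_completion) (auto simp: mult_ac)
  also have "\<dots> = complex_of_real (sqrt (C_const d)) * ?F"
    unfolding fourier_Rd_def by (rule integral_mult_right_zero)
  finally have "B d t = complex_of_real (((2 * pi) powr (- real d / 2))\<^sup>2 * (sqrt (C_const d))\<^sup>2) * ?F\<^sup>2"
    by (simp add: B_def b_hat_def power_mult_distrib)
  also have "?F\<^sup>2 = complex_of_real ((cmod ?F)\<^sup>2)"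
    using complex_norm_square[of ?F] fourier_paraboloid_real[of d t] by (simp add: power2_eq_square)
  also have "((2 * pi) powr (- real d / 2))\<^sup>2 = 1 / (2 * pi) ^ d"
    by (simp add: power2_eq_square powr_add[symmetric] powr_minus_divide powr_realpow)
  also have "(sqrt (C_const d))\<^sup>2 = 1 / paraboloid_mass d"
    using paraboloid_mass_pos[OF d] by (simp add: C_const_eq[OF d])
  finally show ?thesis by (simp add: B_density_def)
qed

section \<open>Total mass and second moment of the kernel\<close>

lemma tendsto_affine_Rd:
  assumes "i < d"
  shows "(\<lambda>n. affine_Rd d (- (1 / real (Suc n))) x z i) \<longlonglongrightarrow> x i"
  using tendsto_add[OF tendsto_const[of "x i"] tendsto_mult[OF tendsto_minus[OF LIMSEQ_Suc[OF lim_1_over_n]] tendsto_const[of "z i"]]] assms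
  by (simp add: affine_Rd_def)

lemma tendsto_shift_affine_Rd:
  assumes "i < d"
  shows "(\<lambda>n. shift_Rd d j h (affine_Rd d (- (1 / real (Suc n))) x z) i) \<longlonglongrightarrow> shift_Rd d j h x i"
  using tendsto_add[OF tendsto_const[of "if i = j then h else 0"] tendsto_affine_Rd[OF assms, of x z]] assms
  by (simp add: shift_Rd_def affine_Rd_def[of d 1])

lemma B_density_integral:
  assumes d: "d \<ge> 1"
  shows "has_bochner_integral (lborel_Rd d) (B_density d) 1"
proof -
  have "has_bochner_integral (lborel_Rd d) (\<lambda>t. (cmod (fourier_Rd d (paraboloid d) t))\<^sup>2)
     ((2 * pi) ^ d * (\<integral>x. (paraboloid d x)\<^sup>2 \<partial>lborel_Rd d))"
  proof (rule plancherel_Rd[where K=1, OF integrable_paraboloid])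
    show "\<bar>paraboloid d x\<bar> \<le> 1" for x using paraboloid_bounds[of d x] by auto
    show "(\<lambda>n. paraboloid d (affine_Rd d (- (1 / real (Suc n))) x z)) \<longlonglongrightarrow> paraboloid d x" for x z
      by (rule tendsto_paraboloid) (rule tendsto_affine_Rd)
  qed
  from has_bochner_integral_divide_zero[OF this, of "(2 * pi) ^ d * paraboloid_mass d"]
  show ?thesis using paraboloid_mass_pos[OF d] by (simp add: B_density_def[abs_def] paraboloid_mass_def)
qed

text \<open>Plancherel for the finite difference, whose transform is that of the paraboloid times a
  phase minus 1. Divided by h^2, the squared factor tends to the square of the j-th coordinate of t,
  so this approximates a second moment.\<close>

lemma difference_B_density_integral:
  assumes j: "j < d"
  shows "has_bochner_integral (lborel_Rd d)
    (\<lambda>t. (cmod (exp (\<i> * complex_of_real (h * t j)) - 1))\<^sup>2 * B_density d t)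
    ((\<integral>x. (paraboloid d (shift_Rd d j h x) - paraboloid d x)\<^sup>2 \<partial>lborel_Rd d) / paraboloid_mass d)"
proof -
  let ?D = "\<lambda>x. paraboloid d (shift_Rd d j h x) - paraboloid d x"
  have "has_bochner_integral (lborel_Rd d) (\<lambda>t. (cmod (fourier_Rd d ?D t))\<^sup>2)
     ((2 * pi) ^ d * (\<integral>x. (?D x)\<^sup>2 \<partial>lborel_Rd d))"
  proof (rule plancherel_Rd[where K=1, OF integrable_difference_paraboloid abs_difference_paraboloid])
    show "(\<lambda>n. ?D (affine_Rd d (- (1 / real (Suc n))) x z)) \<longlonglongrightarrow> ?D x" for x z
      by (intro tendsto_diff tendsto_paraboloid tendsto_shift_affine_Rd tendsto_affine_Rd)
  qed
  from has_bochner_integral_divide_zero[OF this, of "(2 * pi) ^ d * paraboloid_mass d"]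
  show ?thesis
    by (simp add: fourier_difference_paraboloid[OF j] B_density_def norm_mult power_mult_distrib)
qed

text \<open>The limit is the squared modulus of the derivative of exp(i z v) at z = 0, which is i
  v.\<close>

lemma tendsto_exp_difference_quotient:
  assumes "\<And>n. h n > 0" "h \<longlonglongrightarrow> 0"
  shows "(\<lambda>n. (cmod (exp (\<i> * complex_of_real (h n * v)) - 1))\<^sup>2 / (h n)\<^sup>2) \<longlonglongrightarrow> v\<^sup>2"
proof -
  have "((\<lambda>z. exp (\<i> * (z * complex_of_real v))) has_field_derivative \<i> * complex_of_real v) (at 0)"
    by (auto intro!: derivative_eq_intros)
  then have "(\<lambda>z. (exp (\<i> * (z * complex_of_real v)) - 1) / z) \<midarrow>0\<rightarrow> \<i> * complex_of_real v"
    by (simp add: DERIV_def)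
  moreover have "filterlim (\<lambda>n. complex_of_real (h n)) (at 0) sequentially"
    unfolding filterlim_at using assms(1) tendsto_of_real[OF assms(2), where 'a=complex]
    by (simp add: less_imp_neq[THEN not_sym])
  ultimately have "(\<lambda>n. (exp (\<i> * (complex_of_real (h n) * complex_of_real v)) - 1) / complex_of_real (h n)) \<longlonglongrightarrow> \<i> * complex_of_real v"
    by (rule filterlim_compose)
  then have "(\<lambda>n. (cmod ((exp (\<i> * (complex_of_real (h n) * complex_of_real v)) - 1) / complex_of_real (h n)))\<^sup>2) \<longlonglongrightarrow> (cmod (\<i> * complex_of_real v))\<^sup>2"
    by (intro tendsto_intros)
  then show ?thesis by (simp add: norm_divide norm_mult power_divide)
qed

text \<open>
  By Fatou's lemma it suffices to bound the difference quotients, so neither the weak derivatives of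
  the bump nor their Fourier transforms are needed. The constant is \<open>816 = 102 * 8\<close>.
\<close>

lemma B_density_second_moment:
  assumes d: "d \<ge> 1"
  shows "(\<integral>\<^sup>+t. ennreal ((norm2 d t)\<^sup>2 * B_density d t) \<partial>lborel_Rd d) \<le> ennreal (816 * (real d)\<^sup>2)"
proof -
  \<comment> \<open>Steps that tend to 0 but never exceed 1/d, as
    \<open>difference_quotient_energy\<close> demands.\<close>
  define h where "h n = 1 / real (d + n)" for n
  have h: "h n > 0" "h n \<le> 1 / real d" for n using d by (auto simp: h_def field_simps)
  have h0: "h \<longlonglongrightarrow> 0"
    unfolding h_def using LIMSEQ_ignore_initial_segment[OF lim_1_over_n, of d] by (simp add: add.commute)
  let ?u = "\<lambda>n t. \<Sum>j<d. (cmod (exp (\<i> * complex_of_real (h n * t j)) - 1))\<^sup>2 / (h n)\<^sup>2 * B_density d t"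
  have mass: "ball_volume d / paraboloid_mass d \<le> 8 * (real d)\<^sup>2"
    using paraboloid_mass_ge[OF d] paraboloid_mass_pos[OF d] d by (simp add: field_simps)
  have bound: "(\<integral>\<^sup>+t. ennreal (?u n t) \<partial>lborel_Rd d) \<le> ennreal (816 * (real d)\<^sup>2)" for n
  proof -
    have "has_bochner_integral (lborel_Rd d) (?u n)
      (\<Sum>j<d. (\<integral>x. (paraboloid d (shift_Rd d j (h n) x) - paraboloid d x)\<^sup>2 \<partial>lborel_Rd d) / paraboloid_mass d / (h n)\<^sup>2)"
    proof (rule has_bochner_integral_sum)
      fix j assume "j \<in> {..<d}"
      then have "j < d" by simp
      from has_bochner_integral_divide_zero[OF difference_B_density_integral[OF this, of "h n"], of "(h n)\<^sup>2"]
      show "has_bochner_integral (lborel_Rd d) (\<lambda>t. (cmod (exp (\<i> * complex_of_real (h n * t j)) - 1))\<^sup>2 / (h n)\<^sup>2 * B_density d t)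
        ((\<integral>x. (paraboloid d (shift_Rd d j (h n) x) - paraboloid d x)\<^sup>2 \<partial>lborel_Rd d) / paraboloid_mass d / (h n)\<^sup>2)"
        by (simp only: times_divide_eq_left)
    qed
    then have "(\<integral>\<^sup>+t. ennreal (?u n t) \<partial>lborel_Rd d)
      = ennreal (\<Sum>j<d. (\<integral>x. (paraboloid d (shift_Rd d j (h n) x) - paraboloid d x)\<^sup>2 \<partial>lborel_Rd d) / paraboloid_mass d / (h n)\<^sup>2)"
      by (subst nn_integral_eq_integral)
        (auto simp: has_bochner_integral_iff B_density_nonneg[OF d] intro!: sum_nonneg)
    also have "\<dots> \<le> ennreal (816 * (real d)\<^sup>2)"
    proof (rule ennreal_leI)
      have "(\<Sum>j<d. (\<integral>x. (paraboloid d (shift_Rd d j (h n) x) - paraboloid d x)\<^sup>2 \<partial>lborel_Rd d) / paraboloid_mass d / (h n)\<^sup>2)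
        = (\<Sum>j<d. \<integral>x. (paraboloid d (shift_Rd d j (h n) x) - paraboloid d x)\<^sup>2 \<partial>lborel_Rd d) / paraboloid_mass d / (h n)\<^sup>2"
        by (simp add: sum_divide_distrib)
      also have "\<dots> \<le> 102 * (h n)\<^sup>2 * ball_volume d / paraboloid_mass d / (h n)\<^sup>2"
        using paraboloid_mass_pos[OF d] by (intro divide_right_mono difference_quotient_energy[OF d h]) auto
      also have "\<dots> = 102 * (ball_volume d / paraboloid_mass d)" using h(1)[of n] by simp
      also have "\<dots> \<le> 816 * (real d)\<^sup>2" using mass by simp
      finally show "(\<Sum>j<d. (\<integral>x. (paraboloid d (shift_Rd d j (h n) x) - paraboloid d x)\<^sup>2 \<partial>lborel_Rd d) / paraboloid_mass d / (h n)\<^sup>2)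
        \<le> 816 * (real d)\<^sup>2" .
    qed
    finally show ?thesis .
  qed
  have "(\<integral>\<^sup>+t. ennreal ((norm2 d t)\<^sup>2 * B_density d t) \<partial>lborel_Rd d) = (\<integral>\<^sup>+t. liminf (\<lambda>n. ennreal (?u n t)) \<partial>lborel_Rd d)"
  proof (rule nn_integral_cong)
    fix t
    have "(\<lambda>n. ?u n t) \<longlonglongrightarrow> (\<Sum>j<d. (t j)\<^sup>2 * B_density d t)"
      by (intro tendsto_intros tendsto_exp_difference_quotient h h0)
    then have "(\<lambda>n. ennreal (?u n t)) \<longlonglongrightarrow> ennreal ((norm2 d t)\<^sup>2 * B_density d t)"
      by (intro tendsto_ennrealI) (simp add: norm2_sq sum_distrib_right)
    then show "ennreal ((norm2 d t)\<^sup>2 * B_density d t) = liminf (\<lambda>n. ennreal (?u n t))"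
      by (simp add: lim_imp_Liminf)
  qed
  also have "\<dots> \<le> liminf (\<lambda>n. \<integral>\<^sup>+t. ennreal (?u n t) \<partial>lborel_Rd d)"
    by (rule nn_integral_liminf) measurable
  also have "\<dots> \<le> liminf (\<lambda>n::nat. ennreal (816 * (real d)\<^sup>2))"
    by (rule Liminf_mono) (use bound in auto)
  also have "\<dots> = ennreal (816 * (real d)\<^sup>2)" by (simp add: Liminf_const)
  finally show ?thesis .
qed

section \<open>Mollified indicator functions\<close>

lemma diff_Rd_segment:
  "diff_Rd d (affine_Rd d (- s) x y) (affine_Rd d (- s') x y) = scale_Rd d (s' - s) y"
  by (auto simp: diff_Rd_def affine_Rd_def scale_Rd_def fun_eq_iff algebra_simps)

text \<open>The segment from \<open>x\<close> to \<open>x - y\<close> is connected, so it meets the boundary of \<open>R\<close>.\<close>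

lemma d2_boundary_le:
  assumes x: "x \<in> Rd d" and differ: "(x \<in> R) \<noteq> (diff_Rd d x y \<in> R)"
  shows "d2 d x (boundary_Rd d R) \<le> ennreal (norm2 d y)"
proof -
  define p where "p s = affine_Rd d (- s) x y" for s
  have p0: "p 0 = x"
    using x by (auto simp: p_def affine_Rd_def Rd_def PiE_def extensional_def fun_eq_iff)
  have p1: "p 1 = diff_Rd d x y" by (simp add: p_def diff_Rd_eq_affine)
  have dist: "norm2 d (diff_Rd d (p s) (p s')) = \<bar>s' - s\<bar> * norm2 d y" for s s'
    by (simp add: p_def diff_Rd_segment norm2_scale_Rd)
  \<comment> \<open>The added 1 keeps the divisor positive when y has norm 0.\<close>
  have p_ball: "p s' \<in> ball_Rd d (p s) r" if "dist s s' < r / (norm2 d y + 1)" for s s' r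
  proof -
    have "\<bar>s' - s\<bar> * norm2 d y \<le> \<bar>s' - s\<bar> * (norm2 d y + 1)" by (intro mult_left_mono) auto
    also have "\<dots> < r" using that norm2_nonneg[of d y] by (simp add: dist_real_def field_simps abs_minus_commute)
    finally show ?thesis by (simp add: ball_Rd_def dist) (simp add: p_def)
  qed
  \<comment> \<open>Connectedness is used on the parameter line: the frontier of the preimage of
    \<open>R\<close> there is mapped into the boundary of \<open>R\<close>.\<close>
  have "{0..1} \<inter> frontier {s. p s \<in> R} \<noteq> {}"
  proof (rule connected_Int_frontier)
    show "{0..1} \<inter> {s. p s \<in> R} \<noteq> {}" "{0..1} - {s. p s \<in> R} \<noteq> {}"
      using differ p0 p1 by (auto simp: set_eq_iff intro: exI[of _ 0] exI[of _ 1])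
  qed simp
  then obtain s where s: "0 \<le> s" "s \<le> 1" "s \<in> frontier {s. p s \<in> R}" by auto
  have "p s \<in> boundary_Rd d R"
    unfolding boundary_Rd_def
  proof (intro CollectI conjI allI impI)
    show "p s \<in> Rd d" by (simp add: p_def)
    fix r :: real assume "r > 0"
    then have e: "r / (norm2 d y + 1) > 0" by (simp add: add_nonneg_pos)
    from s(3)[unfolded frontier_straddle] e obtain u v
      where uv: "p u \<in> R" "dist s u < r / (norm2 d y + 1)" "p v \<notin> R" "dist s v < r / (norm2 d y + 1)"
      by blast
    show "ball_Rd d (p s) r \<inter> R \<noteq> {}" using uv(1) p_ball[OF uv(2)] by blast
    show "ball_Rd d (p s) r \<inter> (Rd d - R) \<noteq> {}"
      using uv(3) p_ball[OF uv(4)] by (auto simp: ball_Rd_def)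
  qed
  then have "d2 d x (boundary_Rd d R) \<le> ennreal (norm2 d (diff_Rd d (p 0) (p s)))"
    unfolding d2_def p0 by (rule INF_lower)
  also have "\<dots> \<le> ennreal (norm2 d y)"
    unfolding dist using s by (intro ennreal_leI) (auto intro: mult_left_le_one_le)
  finally show ?thesis .
qed

text \<open>Borel measurability of the reflection only handles the Borel part of \<open>R\<close>.
  The remaining part sits inside a null set, whose preimage is again null.\<close>

lemma sets_lebesgue_reflect:
  assumes R: "R \<in> sets (lebesgue_Rd d)"
  shows "{y \<in> Rd d. diff_Rd d x y \<in> R} \<in> sets (lebesgue_Rd d)"
proof -
  from R obtain S N N' where SN: "R = S \<union> N" "N \<subseteq> N'" "N' \<in> null_sets (lborel_Rd d)" "S \<in> sets (lborel_Rd d)"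
    unfolding lebesgue_Rd_def by (rule sets_completionE)
  let ?f = "affine_Rd d (-1) x"
  have N'[measurable]: "N' \<in> sets (lborel_Rd d)" using SN(3) by auto
  have "?f -` N' \<inter> space (lborel_Rd d) \<in> null_sets (lborel_Rd d)"
  proof (rule AE_iff_null_sets[THEN iffD2])
    show "AE y in lborel_Rd d. y \<notin> ?f -` N' \<inter> space (lborel_Rd d)"
      using AE_affine_Rd[OF _ SN(3), of "-1" x] by simp
  qed measurable
  moreover have "?f -` S \<inter> space (lborel_Rd d) \<in> sets (lborel_Rd d)"
    using SN(4) by measurable
  ultimately show ?thesis
    unfolding lebesgue_Rd_def
    by (rule sets_completionI[of _ "?f -` S \<inter> space (lborel_Rd d)" "?f -` N \<inter> space (lborel_Rd d)", rotated 2])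
      (use SN(1,2) in \<open>auto simp: diff_Rd_eq_affine space_lborel_Rd\<close>)
qed

section \<open>The rescaled kernel and the pointwise error\<close>

definition B_scaled_density :: "nat \<Rightarrow> real \<Rightarrow> point \<Rightarrow> real" where
  "B_scaled_density d c y = c ^ d * B_density d (scale_Rd d c y)"

lemma measurable_B_scaled_density [measurable]: "B_scaled_density d c \<in> borel_measurable (lborel_Rd d)"
  unfolding B_scaled_density_def scale_Rd_eq_affine by measurable

lemma B_scaled_density_nonneg: "d \<ge> 1 \<Longrightarrow> c > 0 \<Longrightarrow> 0 \<le> B_scaled_density d c y"
  by (simp add: B_scaled_density_def B_density_nonneg)

lemma B_scaled_density_integral:
  assumes d: "d \<ge> 1" and c: "c > 0"
  shows "integrable (lebesgue_Rd d) (B_scaled_density d c)" "integral\<^sup>L (lebesgue_Rd d) (B_scaled_density d c) = 1"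
proof -
  have int: "integrable (lborel_Rd d) (B_density d)" "integral\<^sup>L (lborel_Rd d) (B_density d) = 1"
    using B_density_integral[OF d] by (auto simp: has_bochner_integral_iff)
  have "integrable (lborel_Rd d) (\<lambda>y. B_density d (scale_Rd d c y))"
    unfolding scale_Rd_eq_affine using c by (intro integrable_affine_Rd int) simp
  then show "integrable (lebesgue_Rd d) (B_scaled_density d c)"
    unfolding lebesgue_Rd_def by (subst integrable_completion) (auto simp: B_scaled_density_def[abs_def])
  have "integral\<^sup>L (lborel_Rd d) (B_density d) = c ^ d * (\<integral>y. B_density d (scale_Rd d c y) \<partial>lborel_Rd d)"
    unfolding scale_Rd_eq_affine using c by (subst integral_affine_Rd[where c=c and a="\<lambda>_. 0"]) auto
  then show "integral\<^sup>L (lebesgue_Rd d) (B_scaled_density d c) = 1"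
    unfolding lebesgue_Rd_def using int(2)
    by (subst integral_completion[OF measurable_B_scaled_density]) (simp add: B_scaled_density_def[abs_def])
qed

text \<open>Under t = c y the factor c^d is the Jacobian, and the squared norm contributes
  1/c^2.\<close>

lemma B_scaled_density_second_moment:
  assumes d: "d \<ge> 1" and c: "c > 0"
  shows "(\<integral>\<^sup>+y. ennreal ((norm2 d y)\<^sup>2 * B_scaled_density d c y) \<partial>lebesgue_Rd d) \<le> ennreal (816 * (real d / c)\<^sup>2)"
proof -
  let ?g = "\<lambda>t. ennreal ((norm2 d t)\<^sup>2 * B_density d t)"
  have "(\<integral>\<^sup>+y. ennreal ((norm2 d y)\<^sup>2 * B_scaled_density d c y) \<partial>lebesgue_Rd d)
     = (\<integral>\<^sup>+y. ennreal (1 / c\<^sup>2) * (ennreal (c ^ d) * ?g (affine_Rd d c (\<lambda>_. 0) y)) \<partial>lborel_Rd d)"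
    unfolding lebesgue_Rd_def nn_integral_completion
  proof (rule nn_integral_cong)
    fix y
    have "(norm2 d y)\<^sup>2 * B_scaled_density d c y
      = 1 / c\<^sup>2 * (c ^ d * ((norm2 d (scale_Rd d c y))\<^sup>2 * B_density d (scale_Rd d c y)))"
      using c by (simp add: B_scaled_density_def norm2_scale_Rd power_mult_distrib)
    then show "ennreal ((norm2 d y)\<^sup>2 * B_scaled_density d c y)
      = ennreal (1 / c\<^sup>2) * (ennreal (c ^ d) * ?g (affine_Rd d c (\<lambda>_. 0) y))"
      using c B_density_nonneg[OF d]
      by (simp only: scale_Rd_eq_affine) (simp add: ennreal_mult'[symmetric] del: times_divide_eq_left)
  qed
  also have "\<dots> = ennreal (1 / c\<^sup>2) * (ennreal (\<bar>c\<bar> ^ d) * (\<integral>\<^sup>+y. ?g (affine_Rd d c (\<lambda>_. 0) y) \<partial>lborel_Rd d))"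
    using c by (simp add: nn_integral_cmult)
  also have "\<dots> = ennreal (1 / c\<^sup>2) * (\<integral>\<^sup>+t. ?g t \<partial>lborel_Rd d)"
    using c by (subst nn_integral_affine_Rd[where c=c and a="\<lambda>_. 0", symmetric]) auto
  also have "\<dots> \<le> ennreal (1 / c\<^sup>2) * ennreal (816 * (real d)\<^sup>2)"
    by (intro mult_left_mono B_density_second_moment d) simp
  also have "\<dots> = ennreal (816 * (real d / c)\<^sup>2)"
    by (simp add: ennreal_mult'[symmetric] power_divide)
  finally show ?thesis .
qed

text \<open>Since the kernel has integral 1, the value at x can be moved under the integral. There
  the two indicators differ by 0 or by 1 in absolute value.\<close>

lemma mollify_indicator_error:
  assumes d: "d \<ge> 1" and R: "R \<in> sets (lebesgue_Rd d)" and c: "c > 0"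
  shows "ennreal (cmod (complex_of_real (indicator R x) - mollify d c (indicator R) x))
    \<le> (\<integral>\<^sup>+y. ennreal (B_scaled_density d c y * (if (x \<in> R) = (diff_Rd d x y \<in> R) then 0 else 1)) \<partial>lebesgue_Rd d)"
proof -
  let ?M = "lebesgue_Rd d" and ?w = "B_scaled_density d c"
  let ?i = "\<lambda>y. indicator R (diff_Rd d x y) :: real"
  note w = B_scaled_density_integral[OF d c]
  have w0: "?w y \<ge> 0" for y by (rule B_scaled_density_nonneg[OF d c])
  have "(indicator {y \<in> Rd d. diff_Rd d x y \<in> R} :: point \<Rightarrow> real) \<in> borel_measurable ?M"
    using sets_lebesgue_reflect[OF R] by (rule borel_measurable_indicator)
  then have i: "?i \<in> borel_measurable ?M"
    by (rule measurable_cong[THEN iffD1, rotated]) (auto simp: space_lebesgue_Rd indicator_def)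
  have wi: "integrable ?M (\<lambda>y. ?w y * ?i y)"
    by (rule Bochner_Integration.integrable_bound[OF w(1)])
      (use i w in \<open>auto simp: indicator_def\<close>)
  have "mollify d c (indicator R) x = (\<integral>y. complex_of_real (?w y * ?i y) \<partial>?M)"
    unfolding mollify_def B_scaled_def B_scaled_density_def B_eq_B_density[OF d] by simp
  also have "\<dots> = complex_of_real (\<integral>y. ?w y * ?i y \<partial>?M)" by (rule integral_complex_of_real)
  finally have "cmod (complex_of_real (indicator R x) - mollify d c (indicator R) x)
    = \<bar>indicator R x - (\<integral>y. ?w y * ?i y \<partial>?M)\<bar>"
    by (simp only: of_real_diff[symmetric] norm_of_real)
  also have "indicator R x - (\<integral>y. ?w y * ?i y \<partial>?M) = (\<integral>y. ?w y * indicator R x - ?w y * ?i y \<partial>?M)"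
    using w wi by (subst Bochner_Integration.integral_diff) auto
  finally have "ennreal (cmod (complex_of_real (indicator R x) - mollify d c (indicator R) x))
    = ennreal (norm (\<integral>y. ?w y * indicator R x - ?w y * ?i y \<partial>?M))" by simp
  also have "\<dots> \<le> (\<integral>\<^sup>+y. ennreal (norm (?w y * indicator R x - ?w y * ?i y)) \<partial>?M)"
    using w wi by (intro integral_norm_bound_ennreal) auto
  also have "\<dots> = (\<integral>\<^sup>+y. ennreal (?w y * (if (x \<in> R) = (diff_Rd d x y \<in> R) then 0 else 1)) \<partial>?M)"
    using w0 by (intro nn_integral_cong) (auto simp: indicator_def)
  finally show ?thesis .
qed

theorem theorem4p9:
  "\<exists>K::real. K > 0 \<and>
    (\<forall>(d::nat) (R::point set) (c::real) (x::point).
       d \<ge> 1 \<longrightarrow> R \<in> sets (lebesgue_Rd d) \<longrightarrow> c > 0 \<longrightarrow> x \<in> Rd d \<longrightarrow>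
       ennreal (cmod (complex_of_real (indicator R x) - mollify d c (indicator R) x))
         \<le> min 1 (ennreal K * (ennreal (real d) / (ennreal c * d2 d x (boundary_Rd d R)))\<^sup>2))"
proof (intro exI[of _ 816] conjI allI impI min.boundedI)
  fix d :: nat and R :: "point set" and c :: real and x :: point
  assume d: "d \<ge> 1" and R: "R \<in> sets (lebesgue_Rd d)" and c: "c > 0" and x: "x \<in> Rd d"
  let ?err = "ennreal (cmod (complex_of_real (indicator R x) - mollify d c (indicator R) x))"
  let ?e = "\<lambda>y. B_scaled_density d c y * (if (x \<in> R) = (diff_Rd d x y \<in> R) then 0 else 1)"
  let ?\<delta> = "d2 d x (boundary_Rd d R)"
  have err: "?err \<le> (\<integral>\<^sup>+y. ennreal (?e y) \<partial>lebesgue_Rd d)" by (rule mollify_indicator_error[OF d R c])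
  have w0: "B_scaled_density d c y \<ge> 0" for y by (rule B_scaled_density_nonneg[OF d c])
  have "(\<integral>\<^sup>+y. ennreal (?e y) \<partial>lebesgue_Rd d) \<le> (\<integral>\<^sup>+y. ennreal (B_scaled_density d c y) \<partial>lebesgue_Rd d)"
    using w0 by (intro nn_integral_mono ennreal_leI) auto
  also have "\<dots> = 1"
    using B_scaled_density_integral[OF d c] w0 by (subst nn_integral_eq_integral) auto
  finally show "?err \<le> 1" using err by (rule order_trans[rotated])
  consider "?\<delta> = 0" | r where "?\<delta> = ennreal r" "r > 0" | "?\<delta> = top"
    by (cases ?\<delta>) (auto simp: less_le)
  then show "?err \<le> ennreal 816 * (ennreal (real d) / (ennreal c * ?\<delta>))\<^sup>2"
  proof cases
    \<comment> \<open>Division by zero in \<open>ennreal\<close> makes the bound infinite, because d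
      is positive.\<close>
    case 1
    then show ?thesis using d by (simp add: ennreal_divide_zero power2_eq_square ennreal_mult_top)
  next
    \<comment> \<open>At infinite distance the bound is 0, so the error must vanish exactly: no
      finite y can reach the other side.\<close>
    case 3
    have "?e y = 0" for y using d2_boundary_le[OF x, of R y] 3 by (auto simp: top_unique)
    then have "(\<integral>\<^sup>+y. ennreal (?e y) \<partial>lebesgue_Rd d) = 0" by (simp only: ennreal_0 nn_integral_const mult_zero_left)
    then show ?thesis using err by simp
  next
    case (2 r)
    \<comment> \<open>Chebyshev in pointwise form: where the indicators differ, the squared norm of
      y is at least r^2.\<close>
    have "ennreal (?e y) \<le> ennreal (1 / r\<^sup>2) * ennreal ((norm2 d y)\<^sup>2 * B_scaled_density d c y)" for y
    proof (cases "(x \<in> R) = (diff_Rd d x y \<in> R)")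
      case False
      then have "r \<le> norm2 d y" using d2_boundary_le[OF x False] 2 by simp
      then have "r\<^sup>2 \<le> (norm2 d y)\<^sup>2" using 2 by (intro power_mono) auto
      then have "B_scaled_density d c y \<le> 1 / r\<^sup>2 * ((norm2 d y)\<^sup>2 * B_scaled_density d c y)"
        using 2 mult_right_mono[OF _ w0, of "r\<^sup>2" "(norm2 d y)\<^sup>2" y] by (simp add: field_simps)
      then have "ennreal (B_scaled_density d c y) \<le> ennreal (1 / r\<^sup>2 * ((norm2 d y)\<^sup>2 * B_scaled_density d c y))"
        by (rule ennreal_leI)
      then show ?thesis using False by (simp only: ennreal_mult' zero_le_divide_1_iff zero_le_power2 if_False mult_1_right)
    qed simp
    then have "(\<integral>\<^sup>+y. ennreal (?e y) \<partial>lebesgue_Rd d)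
      \<le> (\<integral>\<^sup>+y. ennreal (1 / r\<^sup>2) * ennreal ((norm2 d y)\<^sup>2 * B_scaled_density d c y) \<partial>lebesgue_Rd d)"
      by (intro nn_integral_mono)
    also have "\<dots> = ennreal (1 / r\<^sup>2) * (\<integral>\<^sup>+y. ennreal ((norm2 d y)\<^sup>2 * B_scaled_density d c y) \<partial>lebesgue_Rd d)"
      unfolding lebesgue_Rd_def by (intro nn_integral_cmult measurable_completion) measurable
    also have "\<dots> \<le> ennreal (1 / r\<^sup>2) * ennreal (816 * (real d / c)\<^sup>2)"
      by (intro mult_left_mono B_scaled_density_second_moment d c) simp
    also have "\<dots> = ennreal (816 * (real d / (c * r))\<^sup>2)"
      by (simp add: ennreal_mult'[symmetric] power_divide power_mult_distrib)
    also have "\<dots> = ennreal 816 * (ennreal (real d / (c * r)))\<^sup>2"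
      using 2 c by (subst ennreal_power) (simp_all add: ennreal_mult' del: power_divide)
    also have "ennreal (real d / (c * r)) = ennreal (real d) / ennreal (c * r)"
      using 2 c by (intro divide_ennreal[symmetric]) auto
    also have "ennreal (c * r) = ennreal c * ?\<delta>" using 2 c by (simp add: ennreal_mult)
    finally show ?thesis using err by (rule order_trans[rotated])
  qed
qed simp

end
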